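(* Let $(M,\omega_g)$ be a compact Hermitian manifold and let $E$ be a holomorphic vector bundle over $M$. Suppose $h$ and $h_0$ are smooth Hermitian metrics on $E$ and $\lambda\in\mathbb{R}$ is a constant such that $$\Lambda_{\omega_g}\left(\sqrt{-1}R^{h_0}\right)-\lambda h_0>0$$ and $$\Lambda_{\omega_g}\left(\sqrt{-1}R^{h}\right)-\lambda h\ \leq\ \Lambda_{\omega_g}\left(\sqrt{-1}R^{h_0}\right)-\lambda h_0$$ as Hermitian tensors in $\Gamma(M,E^*\otimes\bar E^* )$. Then $h\leq h_0$.
   Context: $\omega_g=\sqrt{-1}\,g_{i\bar j}dz^i\wedge d\bar z^j$ is the fundamental form of a Hermitian metric $g$ on $M$ (no Kähler or Gauduchon condition is imposed). For a smooth Hermitian metric $h$ on $E$, $R^h=R^h_{i\bar j\alpha\bar\beta}\,dz^i\wedge d\bar z^j\otimes e^\alpha\otimes\bar e^\beta\in\Gamma(M,\Lambda^{1,1}T^*M\otimes E^*\otimes\bar E^* )$ is the Chern curvature tensor of $(E,h)$ (with the endomorphism index lowered by $h$), and $\Lambda_{\omega_g}(\sqrt{-1}R^h)=g^{i\bar j}R^h_{i\bar j\alpha\bar\beta}\,e^\alpha\otimes\bar e^\beta\in\Gamma(M,E^*\otimes\bar E^* )$, a Hermitian tensor (field of Hermitian forms on $E$). For Hermitian tensors $A,B\in\Gamma(M,E^*\otimes\bar E^* )$, $A\le B$ (resp. $A<B$) means that $B-A$ is positive semi-definite (resp. positive definite) at every point of $M$. The inequality in the hypothesis is between Hermitian forms,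 not between the associated endomorphisms in $\Gamma(M,E^*\otimes E)$. *)

theory Defs
  imports "HOL-Analysis.Analysis"
begin

section \<open>Calculus on open subsets of complex coordinate space\<close>

primrec Ck_on :: "nat \<Rightarrow> 'a::real_normed_vector set \<Rightarrow> ('a \<Rightarrow> 'b::real_normed_vector) \<Rightarrow> bool" where
  "Ck_on 0 S f \<longleftrightarrow> continuous_on S f"
| "Ck_on (Suc k) S f \<longleftrightarrow>
     (\<forall>x\<in>S. f differentiable (at x)) \<and> (\<forall>v. Ck_on k S (\<lambda>x. frechet_derivative f (at x) v))"

text \<open>Real smoothness. As in \<open>Ck_on\<close>, derivatives are taken at points rather than within the set,
  so this is only used for open sets.\<close>

definition smooth_on :: "'a::real_normed_vector set \<Rightarrow> ('a \<Rightarrow> 'b::real_normed_vector) \<Rightarrow> bool" where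
  "smooth_on S f \<longleftrightarrow> (\<forall>k. Ck_on k S f)"

text \<open>Holomorphic functions of several complex variables, on an open set.\<close>

definition holo_on :: "(complex ^ 'n::finite) set \<Rightarrow> (complex ^ 'n \<Rightarrow> complex) \<Rightarrow> bool" where
  "holo_on S f \<longleftrightarrow>
     (\<forall>z\<in>S. \<exists>D. (f has_derivative D) (at z) \<and> (\<forall>c v. D (c *s v) = c * D v))"

text \<open>The Wirtinger derivatives \<open>\<partial>/\<partial>z\<^sup>i\<close> and \<open>\<partial>/\<partial>\<bar>z\<^sup>i\<close>, where
  \<open>z\<^sup>i = x\<^sup>i + \<i> y\<^sup>i\<close>: the directions \<open>axis i 1\<close> and \<open>axis i \<i>\<close> are
  \<open>\<partial>/\<partial>x\<^sup>i\<close> and \<open>\<partial>/\<partial>y\<^sup>i\<close>.\<close>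

definition wirt :: "'n \<Rightarrow> (complex ^ 'n::finite \<Rightarrow> complex) \<Rightarrow> complex ^ 'n \<Rightarrow> complex" where
  "wirt i f z = (frechet_derivative f (at z) (axis i 1)
                   - \<i> * frechet_derivative f (at z) (axis i \<i>)) / 2"

definition wirt_bar :: "'n \<Rightarrow> (complex ^ 'n::finite \<Rightarrow> complex) \<Rightarrow> complex ^ 'n \<Rightarrow> complex" where
  "wirt_bar i f z = (frechet_derivative f (at z) (axis i 1)
                       + \<i> * frechet_derivative f (at z) (axis i \<i>)) / 2"

text \<open>The sesquilinear form \<open>A\<^sub>\<alpha>\<^sub>\<beta> e\<^sup>\<alpha> \<otimes> \<bar>e\<^sup>\<beta>\<close>: linear in the first, conjugate linear in
  the second argument.\<close>

definition sesq :: "complex ^ 'r ^ 'r \<Rightarrow> complex ^ 'r::finite \<Rightarrow> complex ^ 'r \<Rightarrow> complex" where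
  "sesq A u v = (\<Sum>\<alpha>\<in>UNIV. \<Sum>\<beta>\<in>UNIV. A $ \<alpha> $ \<beta> * u $ \<alpha> * cnj (v $ \<beta>))"

definition hermitian_matrix :: "complex ^ 'r ^ 'r::finite \<Rightarrow> bool" where
  "hermitian_matrix A \<longleftrightarrow> (\<forall>\<alpha> \<beta>. A $ \<beta> $ \<alpha> = cnj (A $ \<alpha> $ \<beta>))"

definition pos_def_matrix :: "complex ^ 'r ^ 'r::finite \<Rightarrow> bool" where
  "pos_def_matrix A \<longleftrightarrow> hermitian_matrix A \<and> (\<forall>v. v \<noteq> 0 \<longrightarrow> 0 < Re (sesq A v v))"


section \<open>Complex manifolds and Hermitian metrics on them\<close>

text \<open>A chart is a coordinate domain together with a coordinate map; the values of the latter
  outside the domain are irrelevant.\<close>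

type_synonym ('m, 'n) chart = "'m set \<times> ('m \<Rightarrow> complex ^ 'n)"

record ('m, 'n::finite) cmfd =
  mtop :: "'m topology"
  atlas :: "('m, 'n) chart set"

definition param :: "('m, 'n::finite) chart \<Rightarrow> complex ^ 'n \<Rightarrow> 'm" where
  "param c = inv_into (fst c) (snd c)"

definition complex_manifold :: "('m, 'n::finite) cmfd \<Rightarrow> bool" where
  "complex_manifold M \<longleftrightarrow>
     Hausdorff_space (mtop M) \<and> second_countable (mtop M) \<and>
     (\<Union>c\<in>atlas M. fst c) = topspace (mtop M) \<and>
     (\<forall>(U, \<phi>)\<in>atlas M. openin (mtop M) U \<and> open (\<phi> ` U) \<and>
        homeomorphic_map (subtopology (mtop M) U) (top_of_set (\<phi> ` U)) \<phi>) \<and>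
     (\<forall>(U, \<phi>)\<in>atlas M. \<forall>(U', \<phi>')\<in>atlas M. \<forall>k.
        holo_on (\<phi> ` (U \<inter> U')) (\<lambda>z. \<phi>' (param (U, \<phi>) z) $ k))"

definition holo_fun :: "('m, 'n::finite) cmfd \<Rightarrow> 'm set \<Rightarrow> ('m \<Rightarrow> complex) \<Rightarrow> bool" where
  "holo_fun M W f \<longleftrightarrow> (\<forall>c\<in>atlas M. holo_on (snd c ` (fst c \<inter> W)) (f \<circ> param c))"

definition smooth_fun ::
  "('m, 'n::finite) cmfd \<Rightarrow> 'm set \<Rightarrow> ('m \<Rightarrow> 'b::real_normed_vector) \<Rightarrow> bool" where
  "smooth_fun M W f \<longleftrightarrow> (\<forall>c\<in>atlas M. smooth_on (snd c ` (fst c \<inter> W)) (f \<circ> param c))"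

text \<open>A Hermitian metric on \<open>M\<close> is given by its components: \<open>g c x $ i $ j\<close> is
  \<open>g\<^sub>i\<^sub>\<bar>\<^sub>j(x)\<close> in the holomorphic coordinates \<open>c\<close>, so that
  \<open>\<omega>\<^sub>g = \<i> g\<^sub>i\<^sub>\<bar>\<^sub>j dz\<^sup>i \<and> d\<bar>z\<^sup>j\<close>. The last clause is the transformation rule of
  such a tensor under a change of coordinates.\<close>

type_synonym ('m, 'n) metric_comps = "('m, 'n) chart \<Rightarrow> 'm \<Rightarrow> complex ^ 'n ^ 'n"

definition hermitian_manifold :: "('m, 'n::finite) cmfd \<Rightarrow> ('m, 'n) metric_comps \<Rightarrow> bool" where
  "hermitian_manifold M g \<longleftrightarrow> complex_manifold M \<and>
     (\<forall>c\<in>atlas M. smooth_fun M (fst c) (g c) \<and> (\<forall>x\<in>fst c. pos_def_matrix (g c x))) \<and>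
     (\<forall>c\<in>atlas M. \<forall>c'\<in>atlas M. \<forall>x\<in>fst c \<inter> fst c'. \<forall>i j.
        g c x $ i $ j =
          (\<Sum>k\<in>UNIV. \<Sum>l\<in>UNIV. g c' x $ k $ l
             * wirt i (\<lambda>z. snd c' (param c z) $ k) (snd c x)
             * cnj (wirt j (\<lambda>z. snd c' (param c z) $ l) (snd c x))))"


section \<open>Holomorphic vector bundles and Hermitian tensors on them\<close>

text \<open>A trivialization is a set \<open>V\<close> of base points together with the fibre component \<open>\<psi>\<close> of a
  local trivialization \<open>u \<mapsto> (\<pi> u, \<psi> u)\<close> over \<open>V\<close>.\<close>

type_synonym ('m, 'e, 'r) triv = "'m set \<times> ('e \<Rightarrow> complex ^ 'r)"

record ('m, 'e, 'r::finite) vbun =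
  etop :: "'e topology"
  proj :: "'e \<Rightarrow> 'm"
  trivs :: "('m, 'e, 'r) triv set"

definition fibre :: "('m, 'e, 'r::finite) vbun \<Rightarrow> 'm \<Rightarrow> 'e set" where
  "fibre E x = {u \<in> topspace (etop E). proj E u = x}"

text \<open>The vector space structure of a fibre is the one transported from \<open>\<complex>\<^sup>r\<close> by any
  trivialization; it does not depend on the trivialization since the transition functions are
  linear on fibres. They are automatically invertible, as trivializations are bijective on
  fibres.\<close>

definition holomorphic_vector_bundle ::
  "('m, 'n::finite) cmfd \<Rightarrow> ('m, 'e, 'r::finite) vbun \<Rightarrow> bool" where
  "holomorphic_vector_bundle M E \<longleftrightarrow>
     proj E ` topspace (etop E) \<subseteq> topspace (mtop M) \<and>
     (\<Union>t\<in>trivs E. fst t) = topspace (mtop M) \<and>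
     (\<forall>(V, \<psi>)\<in>trivs E. openin (mtop M) V \<and>
        homeomorphic_map (subtopology (etop E) {u \<in> topspace (etop E). proj E u \<in> V})
          (prod_topology (subtopology (mtop M) V) euclidean) (\<lambda>u. (proj E u, \<psi> u))) \<and>
     (\<forall>(V, \<psi>)\<in>trivs E. \<forall>(V', \<psi>')\<in>trivs E. \<exists>G :: 'm \<Rightarrow> complex ^ 'r ^ 'r.
        (\<forall>\<alpha> \<beta>. holo_fun M (V \<inter> V') (\<lambda>x. G x $ \<alpha> $ \<beta>)) \<and>
        (\<forall>x\<in>V \<inter> V'. \<forall>u\<in>fibre E x. \<psi>' u = G x *v \<psi> u))"

definition zero_vec :: "('m, 'e, 'r::finite) vbun \<Rightarrow> 'e \<Rightarrow> bool" where
  "zero_vec E u \<longleftrightarrow> (\<exists>t\<in>trivs E. proj E u \<in> fst t \<and> snd t u = 0)"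

text \<open>\<open>frame E t \<alpha>\<close> is the local holomorphic frame \<open>e\<^sub>\<alpha>\<close> of \<open>E\<close> belonging to a trivialization, and
  \<open>comps E t A x $ \<alpha> $ \<beta>\<close> is the component \<open>A\<^sub>\<alpha>\<^sub>\<bar>\<^sub>\<beta>(x) = A(e\<^sub>\<alpha>, e\<^sub>\<beta>)\<close>. Tensors are given as
  functions of two vectors, of which only the values on pairs of vectors of the same fibre
  matter.\<close>

definition frame :: "('m, 'e, 'r::finite) vbun \<Rightarrow> ('m, 'e, 'r) triv \<Rightarrow> 'r \<Rightarrow> 'm \<Rightarrow> 'e" where
  "frame E t \<alpha> x = inv_into (fibre E x) (snd t) (axis \<alpha> 1)"

definition comps :: "('m, 'e, 'r::finite) vbun \<Rightarrow> ('m, 'e, 'r) triv \<Rightarrow> ('e \<Rightarrow> 'e \<Rightarrow> complex) \<Rightarrow>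
    'm \<Rightarrow> complex ^ 'r ^ 'r" where
  "comps E t A x = (\<chi> \<alpha> \<beta>. A (frame E t \<alpha> x) (frame E t \<beta> x))"

definition hermitian_tensor :: "('m, 'e, 'r::finite) vbun \<Rightarrow> ('e \<Rightarrow> 'e \<Rightarrow> complex) \<Rightarrow> bool" where
  "hermitian_tensor E A \<longleftrightarrow>
     (\<forall>t\<in>trivs E. \<forall>x\<in>fst t. \<forall>u\<in>fibre E x. \<forall>v\<in>fibre E x.
        A u v = sesq (comps E t A x) (snd t u) (snd t v) \<and> A v u = cnj (A u v))"

text \<open>The values \<open>A u u\<close> of a Hermitian tensor are real, so that the real parts in the following
  two definitions carry all the information.\<close>

definition pos_semidef :: "('m, 'e, 'r::finite) vbun \<Rightarrow> ('e \<Rightarrow> 'e \<Rightarrow> complex) \<Rightarrow> bool" where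
  "pos_semidef E A \<longleftrightarrow> (\<forall>u\<in>topspace (etop E). 0 \<le> Re (A u u))"

definition pos_def :: "('m, 'e, 'r::finite) vbun \<Rightarrow> ('e \<Rightarrow> 'e \<Rightarrow> complex) \<Rightarrow> bool" where
  "pos_def E A \<longleftrightarrow> (\<forall>u\<in>topspace (etop E). \<not> zero_vec E u \<longrightarrow> 0 < Re (A u u))"

definition tensor_le ::
  "('m, 'e, 'r::finite) vbun \<Rightarrow> ('e \<Rightarrow> 'e \<Rightarrow> complex) \<Rightarrow> ('e \<Rightarrow> 'e \<Rightarrow> complex) \<Rightarrow> bool" where
  "tensor_le E A B \<longleftrightarrow> pos_semidef E (\<lambda>u v. B u v - A u v)"

definition tensor_less ::
  "('m, 'e, 'r::finite) vbun \<Rightarrow> ('e \<Rightarrow> 'e \<Rightarrow> complex) \<Rightarrow> ('e \<Rightarrow> 'e \<Rightarrow> complex) \<Rightarrow> bool" where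
  "tensor_less E A B \<longleftrightarrow> pos_def E (\<lambda>u v. B u v - A u v)"

definition hermitian_metric ::
  "('m, 'n::finite) cmfd \<Rightarrow> ('m, 'e, 'r::finite) vbun \<Rightarrow> ('e \<Rightarrow> 'e \<Rightarrow> complex) \<Rightarrow> bool" where
  "hermitian_metric M E h \<longleftrightarrow> hermitian_tensor E h \<and> pos_def E h \<and>
     (\<forall>t\<in>trivs E. smooth_fun M (fst t) (comps E t h))"


section \<open>The Chern curvature\<close>

text \<open>Let \<open>H = (h\<^sub>\<alpha>\<^sub>\<bar>\<^sub>\<beta>)\<close> be the components of a metric in a holomorphic frame, as a function of
  holomorphic coordinates. The Chern connection is
  \<open>\<nabla>e\<^sub>\<alpha> = \<Gamma>\<^sub>i\<^sub>\<alpha>\<^sup>\<gamma> dz\<^sup>i \<otimes> e\<^sub>\<gamma>\<close> (its (0,1) part is the \<open>\<bar>\<partial>\<close> operator of the bundle, which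
  annihilates the frame), where metric compatibility
  \<open>\<partial>\<^sub>i h\<^sub>\<alpha>\<^sub>\<bar>\<^sub>\<beta> = \<Gamma>\<^sub>i\<^sub>\<alpha>\<^sup>\<gamma> h\<^sub>\<gamma>\<^sub>\<bar>\<^sub>\<beta>\<close> forces \<open>\<Gamma>\<^sub>i = \<partial>\<^sub>iH \<cdot> H\<^sup>-\<^sup>1\<close>; the entry \<open>$ \<alpha> $ \<gamma>\<close> of
  \<open>chern_conn H i z\<close> is \<open>\<Gamma>\<^sub>i\<^sub>\<alpha>\<^sup>\<gamma>\<close>.\<close>

definition wirt_matrix ::
  "'n \<Rightarrow> (complex ^ 'n::finite \<Rightarrow> complex ^ 'r ^ 'r) \<Rightarrow> complex ^ 'n \<Rightarrow> complex ^ 'r ^ 'r::finite" where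
  "wirt_matrix i H z = (\<chi> \<alpha> \<beta>. wirt i (\<lambda>w. H w $ \<alpha> $ \<beta>) z)"

definition chern_conn ::
  "(complex ^ 'n::finite \<Rightarrow> complex ^ 'r ^ 'r) \<Rightarrow> 'n \<Rightarrow> complex ^ 'n \<Rightarrow> complex ^ 'r ^ 'r::finite" where
  "chern_conn H i z = wirt_matrix i H z ** matrix_inv (H z)"

lemma chern_conn_unique:
  fixes H :: "complex ^ 'n::finite \<Rightarrow> complex ^ 'r ^ 'r::finite"
  assumes "invertible (H z)"
  shows "wirt_matrix i H z = \<Gamma> ** H z \<longleftrightarrow> \<Gamma> = chern_conn H i z"
proof -
  have inv: "matrix_inv (H z) ** H z = mat 1" "H z ** matrix_inv (H z) = mat 1"
    using someI_ex[OF assms[unfolded invertible_def]] by (simp_all add: matrix_inv_def)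
  show ?thesis
    unfolding chern_conn_def
    by (metis inv matrix_mul_assoc matrix_mul_rid)
qed

text \<open>The curvature \<open>[\<nabla>\<^sub>i, \<nabla>\<^sub>\<bar>\<^sub>j] e\<^sub>\<alpha> = R\<^sub>i\<^sub>\<bar>\<^sub>j\<^sub>\<alpha>\<^sup>\<gamma> e\<^sub>\<gamma>\<close> has
  \<open>R\<^sub>i\<^sub>\<bar>\<^sub>j\<^sub>\<alpha>\<^sup>\<gamma> = - \<partial>\<^sub>\<bar>\<^sub>j \<Gamma>\<^sub>i\<^sub>\<alpha>\<^sup>\<gamma>\<close>, and
  \<open>R\<^sub>i\<^sub>\<bar>\<^sub>j\<^sub>\<alpha>\<^sub>\<bar>\<^sub>\<beta> = R\<^sub>i\<^sub>\<bar>\<^sub>j\<^sub>\<alpha>\<^sup>\<gamma> h\<^sub>\<gamma>\<^sub>\<bar>\<^sub>\<beta>\<close>.\<close>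

definition chern_curv_endo :: "(complex ^ 'n::finite \<Rightarrow> complex ^ 'r ^ 'r) \<Rightarrow> 'n \<Rightarrow> 'n \<Rightarrow>
    complex ^ 'n \<Rightarrow> complex ^ 'r ^ 'r::finite" where
  "chern_curv_endo H i j z = (\<chi> \<alpha> \<gamma>. - wirt_bar j (\<lambda>w. chern_conn H i w $ \<alpha> $ \<gamma>) z)"

definition chern_curv :: "(complex ^ 'n::finite \<Rightarrow> complex ^ 'r ^ 'r) \<Rightarrow> 'n \<Rightarrow> 'n \<Rightarrow>
    complex ^ 'n \<Rightarrow> complex ^ 'r ^ 'r::finite" where
  "chern_curv H i j z = chern_curv_endo H i j z ** H z"

text \<open>The components \<open>g\<^sup>i\<^sup>\<bar>\<^sup>j R\<^sub>i\<^sub>\<bar>\<^sub>j\<^sub>\<alpha>\<^sub>\<bar>\<^sub>\<beta>\<close> at a point, with respect to a chart \<open>c\<close> and the frame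
  of \<open>t\<close>. Since \<open>g\<^sup>i\<^sup>\<bar>\<^sup>j g\<^sub>k\<^sub>\<bar>\<^sub>j = \<delta>\<^sup>i\<^sub>k\<close>, the number \<open>g\<^sup>i\<^sup>\<bar>\<^sup>j\<close> is the \<open>(j, i)\<close> entry of the inverse
  matrix of \<open>(g\<^sub>i\<^sub>\<bar>\<^sub>j)\<close>.\<close>

definition mean_curv_comps :: "('m, 'e, 'r::finite) vbun \<Rightarrow> ('m, 'n::finite) metric_comps \<Rightarrow>
    ('e \<Rightarrow> 'e \<Rightarrow> complex) \<Rightarrow> ('m, 'n) chart \<Rightarrow> ('m, 'e, 'r) triv \<Rightarrow> 'm \<Rightarrow> complex ^ 'r ^ 'r" where
  "mean_curv_comps E g h c t x = (\<chi> \<alpha> \<beta>. \<Sum>i\<in>UNIV. \<Sum>j\<in>UNIV.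
     matrix_inv (g c x) $ j $ i * chern_curv (comps E t h \<circ> param c) i j (snd c x) $ \<alpha> $ \<beta>)"

text \<open>The tensor \<open>\<Lambda>\<^bsub>\<omega>\<^sub>g\<^esub>(\<i> R\<^sup>h) = g\<^sup>i\<^sup>\<bar>\<^sup>j R\<^sub>i\<^sub>\<bar>\<^sub>j\<^sub>\<alpha>\<^sub>\<bar>\<^sub>\<beta> e\<^sup>\<alpha> \<otimes> \<bar>e\<^sup>\<beta>\<close>, evaluated on two vectors of the
  same fibre by means of some chart and some trivialization around their base point. As the
  expression is tensorial, the value is the same for all choices.\<close>

definition chart_at :: "('m, 'n::finite) cmfd \<Rightarrow> 'm \<Rightarrow> ('m, 'n) chart" where
  "chart_at M x = (SOME c. c \<in> atlas M \<and> x \<in> fst c)"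

definition triv_at :: "('m, 'e, 'r::finite) vbun \<Rightarrow> 'm \<Rightarrow> ('m, 'e, 'r) triv" where
  "triv_at E x = (SOME t. t \<in> trivs E \<and> x \<in> fst t)"

definition mean_curv :: "('m, 'n::finite) cmfd \<Rightarrow> ('m, 'n) metric_comps \<Rightarrow>
    ('m, 'e, 'r::finite) vbun \<Rightarrow> ('e \<Rightarrow> 'e \<Rightarrow> complex) \<Rightarrow> 'e \<Rightarrow> 'e \<Rightarrow> complex" where
  "mean_curv M g E h u v =
     (let x = proj E u; c = chart_at M x; t = triv_at E x
      in sesq (mean_curv_comps E g h c t x) (snd t u) (snd t v))"

end

theory Submission
  imports Defs
begin

text \<open>Let \<open>\<mu>\<close> be the maximum of \<open>h(v,v) / h\<^sub>0(v,v)\<close> over the nonzero vectors of \<open>E\<close>, attained at \<open>u\<close> over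
  \<open>x\<close>, and suppose \<open>\<mu> > 1\<close>. Extend \<open>u\<close> to a local holomorphic section \<open>s\<close> whose \<open>h\<^sub>0\<close>-covariant derivative
  vanishes at \<open>x\<close>. The function \<open>\<mu> h\<^sub>0(s,s) - h(s,s)\<close> has a local minimum at \<open>x\<close>, so the \<open>g\<close>-trace of its Levi
  form is nonnegative there. That trace equals
  \<open>- \<mu> \<Lambda>(\<i> R\<^sup>h\<^sup>0)(u,u) + \<Lambda>(\<i> R\<^sup>h)(u,u) - |\<nabla>\<^sup>h s|\<^sup>2\<close>, whence \<open>\<Lambda>(\<i> R\<^sup>h)(u,u) \<ge> \<mu> \<Lambda>(\<i> R\<^sup>h\<^sup>0)(u,u)\<close>.
  Subtracting \<open>\<lambda> h(u,u) = \<lambda> \<mu> h\<^sub>0(u,u)\<close> contradicts the hypotheses, because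
  \<open>\<Lambda>(\<i> R\<^sup>h\<^sup>0) - \<lambda> h\<^sub>0 > 0\<close>.\<close>

section \<open>Sesquilinear forms and positive matrices\<close>

lemma sesq_add_left: "sesq A (u + v) w = sesq A u w + sesq A v w"
  by (simp add: sesq_def sum.distrib algebra_simps)

lemma sesq_add_right: "sesq A w (u + v) = sesq A w u + sesq A w v"
  by (simp add: sesq_def sum.distrib algebra_simps)

lemma sesq_scale_left: "sesq A (c *s u) v = c * sesq A u v"
  by (simp add: sesq_def sum_distrib_left mult_ac)

lemma sesq_scale_right: "sesq A u (c *s v) = cnj c * sesq A u v"
  by (simp add: sesq_def sum_distrib_left mult_ac)

lemma sesq_zero_left [simp]: "sesq A 0 v = 0"
  by (simp add: sesq_def)

lemma sesq_zero_right [simp]: "sesq A u 0 = 0"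
  by (simp add: sesq_def)

lemma sesq_sum_left: "sesq A (\<Sum>i\<in>S. f i) v = (\<Sum>i\<in>S. sesq A (f i) v)"
  by (induction S rule: infinite_finite_induct) (simp_all add: sesq_add_left)

lemma sesq_sum_right: "sesq A u (\<Sum>i\<in>S. f i) = (\<Sum>i\<in>S. sesq A u (f i))"
  by (induction S rule: infinite_finite_induct) (simp_all add: sesq_add_right)

lemma sesq_diff_matrix: "sesq (A - B) u v = sesq A u v - sesq B u v"
  by (simp add: sesq_def algebra_simps sum_subtractf)

text \<open>The first index of a form is paired with \<open>u\<close>, so a left factor acts on
  \<open>u\<close> as on a row vector. This is why connection matrices later enter as
  \<open>u v* chern_conn H i z\<close>.\<close>

lemma sesq_matrix_mult_left: "sesq (A ** B) u v = sesq B (u v* A) v"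
proof -
  have "sesq (A ** B) u v = (\<Sum>\<alpha>\<in>UNIV. \<Sum>\<beta>\<in>UNIV. \<Sum>k\<in>UNIV. A$\<alpha>$k * B$k$\<beta> * u$\<alpha> * cnj (v$\<beta>))"
    by (simp add: sesq_def matrix_matrix_mult_def sum_distrib_right)
  also have "\<dots> = (\<Sum>\<beta>\<in>UNIV. \<Sum>\<alpha>\<in>UNIV. \<Sum>k\<in>UNIV. A$\<alpha>$k * B$k$\<beta> * u$\<alpha> * cnj (v$\<beta>))"
    by (rule sum.swap)
  also have "\<dots> = (\<Sum>\<beta>\<in>UNIV. \<Sum>k\<in>UNIV. \<Sum>\<alpha>\<in>UNIV. A$\<alpha>$k * B$k$\<beta> * u$\<alpha> * cnj (v$\<beta>))"
    by (intro sum.cong refl sum.swap)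
  also have "\<dots> = (\<Sum>k\<in>UNIV. \<Sum>\<beta>\<in>UNIV. \<Sum>\<alpha>\<in>UNIV. A$\<alpha>$k * B$k$\<beta> * u$\<alpha> * cnj (v$\<beta>))"
    by (rule sum.swap)
  also have "\<dots> = sesq B (u v* A) v"
    by (simp add: sesq_def vector_matrix_mult_def sum_distrib_right sum_distrib_left mult_ac)
  finally show ?thesis .
qed

definition adjoint_matrix :: "complex ^ 'r ^ 'r::finite \<Rightarrow> complex ^ 'r ^ 'r" where
  "adjoint_matrix A = (\<chi> \<alpha> \<beta>. cnj (A $ \<beta> $ \<alpha>))"

text \<open>The counterpart for the second argument, where the conjugation in \<open>sesq\<close>
  cancels the one in the adjoint.\<close>

lemma sesq_matrix_adjoint_right: "sesq (A ** adjoint_matrix B) u v = sesq A u (v v* B)"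
proof -
  have "sesq (A ** adjoint_matrix B) u v
      = (\<Sum>\<alpha>\<in>UNIV. \<Sum>\<beta>\<in>UNIV. \<Sum>k\<in>UNIV. A$\<alpha>$k * cnj (B$\<beta>$k) * u$\<alpha> * cnj (v$\<beta>))"
    by (simp add: sesq_def matrix_matrix_mult_def sum_distrib_right adjoint_matrix_def)
  also have "\<dots> = (\<Sum>\<alpha>\<in>UNIV. \<Sum>k\<in>UNIV. \<Sum>\<beta>\<in>UNIV. A$\<alpha>$k * cnj (B$\<beta>$k) * u$\<alpha> * cnj (v$\<beta>))"
    by (intro sum.cong refl sum.swap)
  also have "\<dots> = sesq A u (v v* B)"
    by (simp add: sesq_def vector_matrix_mult_def sum_distrib_right sum_distrib_left mult_ac)
  finally show ?thesis .
qed

lemma adjoint_matrix_mult: "adjoint_matrix (A ** B) = adjoint_matrix B ** adjoint_matrix A"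
  by (simp add: adjoint_matrix_def matrix_matrix_mult_def vec_eq_iff mult_ac)

lemma hermitian_matrix_adjoint: "hermitian_matrix A \<longleftrightarrow> adjoint_matrix A = A"
  unfolding hermitian_matrix_def adjoint_matrix_def vec_eq_iff vec_lambda_beta by metis

lemma hermitian_matrixD: "hermitian_matrix A \<Longrightarrow> cnj (A $ i $ j) = A $ j $ i"
  unfolding hermitian_matrix_def by metis

lemma adjoint_mat_1 [simp]: "adjoint_matrix (mat 1) = mat 1"
  by (simp add: adjoint_matrix_def vec_eq_iff mat_def)

lemma sesq_cnj: "hermitian_matrix A \<Longrightarrow> cnj (sesq A u v) = sesq A v u"
proof -
  assume h: "hermitian_matrix A"
  have "cnj (sesq A u v) = (\<Sum>\<alpha>\<in>UNIV. \<Sum>\<beta>\<in>UNIV. A $ \<beta> $ \<alpha> * v $ \<beta> * cnj (u $ \<alpha>))"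
    by (simp add: sesq_def mult_ac hermitian_matrixD[OF h])
  also have "\<dots> = sesq A v u"
    unfolding sesq_def by (rule sum.swap)
  finally show ?thesis .
qed

lemma Im_sesq_hermitian: "hermitian_matrix A \<Longrightarrow> Im (sesq A u u) = 0"
  using sesq_cnj[of A u u] by (simp add: complex_eq_iff)

lemma pos_def_matrix_sesq_nonneg: "pos_def_matrix A \<Longrightarrow> 0 \<le> Re (sesq A v v)"
  by (cases "v = 0") (auto simp: pos_def_matrix_def less_imp_le)

section \<open>Invertibility of positive definite matrices and positivity of their inverses\<close>

lemma sesq_matrix_vector: "sesq A u v = (\<Sum>\<alpha>\<in>UNIV. u $ \<alpha> * (A *v (\<chi> \<beta>. cnj (v $ \<beta>))) $ \<alpha>)"
  by (simp add: sesq_def matrix_vector_mult_def sum_distrib_left mult_ac)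

text \<open>The conjugate of a kernel vector is isotropic for the form, hence zero; the conjugate
  appears because \<open>sesq\<close> conjugates its second argument.\<close>

lemma pos_def_matrix_invertible:
  assumes "pos_def_matrix A"
  shows "invertible A"
proof -
  have "v = 0" if "A *v v = 0" for v
  proof -
    have "sesq A (\<chi> \<beta>. cnj (v $ \<beta>)) (\<chi> \<beta>. cnj (v $ \<beta>)) = 0"
      using that by (simp add: sesq_matrix_vector)
    then have "(\<chi> \<beta>. cnj (v $ \<beta>)) = 0"
      using assms by (metis pos_def_matrix_def less_irrefl zero_complex.sel(1))
    then show "v = 0"
      by (simp add: vec_eq_iff)
  qed
  then show ?thesis
    using matrix_left_invertible_ker invertible_left_inverse by blast
qed

lemma matrix_inv_right_left:
  assumes "invertible A"
  shows "A ** matrix_inv A = mat 1" "matrix_inv A ** A = mat 1"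
  using someI_ex[OF assms[unfolded invertible_def]] by (simp_all add: matrix_inv_def)

text \<open>Since \<open>?P = ?P ** A ** adjoint_matrix ?P\<close>, the form of the inverse at
  \<open>v\<close> is the form of \<open>A\<close> at \<open>v v* ?P\<close>.\<close>

lemma pos_def_matrix_inv:
  assumes A: "pos_def_matrix A"
  shows "hermitian_matrix (matrix_inv A)" "0 \<le> Re (sesq (matrix_inv A) v v)"
proof -
  let ?P = "matrix_inv A"
  note inv = matrix_inv_right_left[OF pos_def_matrix_invertible[OF A]]
  have hA: "adjoint_matrix A = A"
    using A by (simp add: pos_def_matrix_def hermitian_matrix_adjoint)
  have 1: "adjoint_matrix ?P ** A = mat 1"
    by (metis adjoint_matrix_mult hA inv(1) adjoint_mat_1)
  have hP: "adjoint_matrix ?P = ?P"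
    by (metis 1 inv(1) matrix_mul_assoc matrix_mul_lid matrix_mul_rid)
  then show "hermitian_matrix ?P"
    by (simp add: hermitian_matrix_adjoint)
  have "?P = ?P ** A ** adjoint_matrix ?P"
    by (simp add: hP inv)
  then have "sesq ?P v v = sesq A (v v* ?P) (v v* ?P)"
    by (metis sesq_matrix_adjoint_right sesq_matrix_mult_left)
  then show "0 \<le> Re (sesq ?P v v)"
    using pos_def_matrix_sesq_nonneg[OF A] by simp
qed

text \<open>Elimination of one index at a time exhibits a positive semidefinite matrix as a sum of rank-one matrices.\<close>

lemma trace_prod_nonneg_on:
  fixes P L :: "complex ^ 'n ^ 'n::finite"
  assumes "finite S"
    and "hermitian_matrix P" and "\<And>v. 0 \<le> Re (sesq P v v)"
    and "\<And>v. 0 \<le> Re (sesq L v v)"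
    and "\<And>i j. i \<notin> S \<Longrightarrow> P $ i $ j = 0"
  shows "0 \<le> Re (\<Sum>i\<in>UNIV. \<Sum>j\<in>UNIV. P $ j $ i * L $ i $ j)"
  using assms
proof (induction S arbitrary: P rule: finite_induct)
  case empty
  then show ?case by simp
next
  case (insert k S)
  note her = insert.prems(1) and psd = insert.prems(2) and supp = insert.prems(4)
  have cnjP: "cnj (P$i$j) = P$j$i" for i j
    by (rule hermitian_matrixD[OF her])
  define p where "p = Re (P$k$k)"
  have Pkk: "P$k$k = of_real p"
    using cnjP[of k k] by (simp add: p_def complex_eq_iff)
  have ax: "sesq P (axis k 1) v = (\<Sum>\<beta>\<in>UNIV. P$k$\<beta> * cnj (v$\<beta>))" for v
  proof -
    have "sesq P (axis k 1) v = (\<Sum>\<alpha>\<in>UNIV. if \<alpha> = k then (\<Sum>\<beta>\<in>UNIV. P$k$\<beta> * cnj (v$\<beta>)) else 0)"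
      unfolding sesq_def by (intro sum.cong refl) (auto simp: axis_def)
    then show ?thesis by simp
  qed
  have ax1: "sesq P (axis k 1) (axis j 1) = P$k$j" for j
    unfolding ax by (subst sum.remove[of _ j]) (auto simp: axis_def intro!: sum.neutral)
  have ax2: "sesq P v (axis k 1) = (\<Sum>\<beta>\<in>UNIV. P$\<beta>$k * v$\<beta>)" for v
    using sesq_cnj[OF her, of "axis k 1" v] by (simp add: ax cnjP)
  \<comment> \<open>A quadratic expression in \<open>c\<close> with leading coefficient
    \<open>p\<close>; both cases below insert a suitable \<open>c\<close>.\<close>
  have quad: "Re (sesq P (v + c *s axis k 1) (v + c *s axis k 1))
      = Re (sesq P v v) + 2 * Re (c * sesq P (axis k 1) v) + (cmod c)\<^sup>2 * p" for v c
  proof -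
    have 1: "sesq P v (axis k 1) = cnj (sesq P (axis k 1) v)"
      by (simp add: sesq_cnj[OF her])
    have "sesq P (v + c *s axis k 1) (v + c *s axis k 1)
       = sesq P v v + (c * sesq P (axis k 1) v + cnj (c * sesq P (axis k 1) v)) + c * cnj c * of_real p"
      by (simp add: sesq_add_left sesq_add_right sesq_scale_left sesq_scale_right 1 ax1 Pkk algebra_simps)
    also have "c * cnj c = of_real ((cmod c)\<^sup>2)"
      by (metis complex_norm_square)
    finally show ?thesis
      by simp
  qed
  show ?case
  proof (cases "p = 0")
    case True
    have "P$k$j = 0" for j
    proof (rule ccontr)
      assume nz: "P$k$j \<noteq> 0"
      define v :: "complex ^ 'n" where "v = axis j 1"
      \<comment> \<open>For \<open>p = 0\<close> the expression in \<open>quad\<close> is affine in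
        \<open>c\<close>. This multiple of \<open>cnj (P$k$j)\<close> makes the linear term
        \<open>- 2 * (Re (sesq P v v) + 1)\<close>, which pushes the value below zero.\<close>
      define c where "c = - of_real ((Re (sesq P v v) + 1) / (cmod (P$k$j))\<^sup>2) * cnj (P$k$j)"
      have "c * P$k$j = - of_real ((Re (sesq P v v) + 1) / (cmod (P$k$j))\<^sup>2) * of_real ((cmod (P$k$j))\<^sup>2)"
        unfolding c_def mult.assoc using complex_norm_square[of "P$k$j"] by (simp add: mult.commute)
      also have "\<dots> = - of_real (Re (sesq P v v) + 1)"
        using nz by (simp del: of_real_power flip: of_real_mult)
      finally have "c * P$k$j = - of_real (Re (sesq P v v) + 1)" .
      then have "Re (sesq P (v + c *s axis k 1) (v + c *s axis k 1)) = - Re (sesq P v v) - 2"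
        unfolding quad by (simp add: v_def ax1 True)
      with psd[of "v + c *s axis k 1"] psd[of v] show False by linarith
    qed
    then show ?thesis
      using insert.prems by (intro insert.IH) (auto, metis)
  next
    case False
    have "0 \<le> p"
      using psd[of "axis k 1"] by (simp add: ax1 Pkk)
    with False have p: "p > 0" by simp
    \<comment> \<open>The Schur complement of the pivot \<open>P$k$k\<close>: its row
      \<open>k\<close> vanishes, so only rows in \<open>S\<close> remain and the induction
      hypothesis applies.\<close>
    define Q :: "complex ^ 'n ^ 'n" where "Q = (\<chi> i j. P$i$j - P$i$k * P$k$j / of_real p)"
    have Q: "sesq Q v v = sesq P v v - of_real ((cmod (sesq P (axis k 1) v))\<^sup>2 / p)" for v
    proof -
      have "sesq Q v v = sesq P v v - (\<Sum>\<alpha>\<in>UNIV. \<Sum>\<beta>\<in>UNIV. (P$\<alpha>$k * v$\<alpha>) * (P$k$\<beta> * cnj (v$\<beta>))) / of_real p"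
        unfolding sesq_def Q_def
        by (simp add: algebra_simps sum_subtractf sum_divide_distrib)
      also have "(\<Sum>\<alpha>\<in>UNIV. \<Sum>\<beta>\<in>UNIV. (P$\<alpha>$k * v$\<alpha>) * (P$k$\<beta> * cnj (v$\<beta>)))
          = sesq P v (axis k 1) * sesq P (axis k 1) v"
        by (simp add: ax ax2 sum_product)
      also have "\<dots> = of_real ((cmod (sesq P (axis k 1) v))\<^sup>2)"
        unfolding complex_norm_square sesq_cnj[OF her] by (simp add: mult.commute)
      finally show ?thesis by simp
    qed
    have "0 \<le> Re (sesq Q v v)" for v
    proof -
      \<comment> \<open>The minimizer of \<open>quad\<close> in \<open>c\<close>; the minimum value
        is the form of \<open>Q\<close> at \<open>v\<close>.\<close>
      define c where "c = - cnj (sesq P (axis k 1) v) / of_real p"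
      define m where "m = cmod (sesq P (axis k 1) v)"
      have 1: "c * sesq P (axis k 1) v = of_real (- (m\<^sup>2) / p)"
        using complex_norm_square[of "sesq P (axis k 1) v"]
        by (simp add: c_def m_def mult.commute)
      have "cmod c = m / p"
        using p by (simp add: c_def m_def norm_divide)
      then have "(cmod c)\<^sup>2 * p = m\<^sup>2 / p"
        using p by (simp add: power2_eq_square)
      then have "0 \<le> Re (sesq P v v) - m\<^sup>2 / p"
        using psd[of "v + c *s axis k 1"] unfolding quad 1 by simp
      then show ?thesis by (simp add: Q m_def)
    qed
    moreover have "hermitian_matrix Q"
      unfolding hermitian_matrix_def by (simp add: Q_def cnjP mult.commute)
    moreover have "Q$i$j = 0" if "i \<notin> S" for i j
    proof (cases "i = k")
      case True
      then show ?thesis using p by (simp add: Q_def Pkk)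
    next
      case False
      then show ?thesis using supp[of i] that by (simp add: Q_def)
    qed
    ultimately have IH: "0 \<le> Re (\<Sum>i\<in>UNIV. \<Sum>j\<in>UNIV. Q $ j $ i * L $ i $ j)"
      using insert.prems(3) by (intro insert.IH) auto
    \<comment> \<open>\<open>P - Q\<close> has rank one, and its trace against \<open>L\<close> is
      the form of \<open>L\<close> at row \<open>k\<close> of \<open>P\<close>, divided by
      \<open>p\<close>.\<close>
    have "(\<Sum>i\<in>UNIV. \<Sum>j\<in>UNIV. P $ j $ i * L $ i $ j) = (\<Sum>i\<in>UNIV. \<Sum>j\<in>UNIV. Q $ j $ i * L $ i $ j)
       + sesq L (\<chi> i. P$k$i) (\<chi> i. P$k$i) / of_real p"
      by (simp add: Q_def sesq_def cnjP algebra_simps sum_subtractf sum_divide_distrib)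
    then show ?thesis
      using IH insert.prems(3)[of "\<chi> i. P$k$i"] p by simp
  qed
qed

lemma trace_prod_nonneg:
  fixes P L :: "complex ^ 'n ^ 'n::finite"
  assumes "hermitian_matrix P" and "\<And>v. 0 \<le> Re (sesq P v v)" and "\<And>v. 0 \<le> Re (sesq L v v)"
  shows "0 \<le> Re (\<Sum>i\<in>UNIV. \<Sum>j\<in>UNIV. P $ j $ i * L $ i $ j)"
  using trace_prod_nonneg_on[of UNIV P L] assms by auto


section \<open>Wirtinger calculus and the Levi form\<close>

abbreviation "fd f z v \<equiv> frechet_derivative f (at z) v"

lemma fd_eqI: "(f has_derivative D) (at z) \<Longrightarrow> frechet_derivative f (at z) v = D v"
  by (simp add: frechet_derivative_at[symmetric])

lemma fd_bounded_linear:
  assumes "bounded_linear L" "f differentiable at z"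
  shows "frechet_derivative (\<lambda>w. L (f w)) (at z) v = L (frechet_derivative f (at z) v)"
  by (rule fd_eqI[OF bounded_linear.has_derivative[OF assms(1) assms(2)[unfolded frechet_derivative_works]]])

lemma fd_add:
  assumes "f differentiable at z" "g differentiable at z"
  shows "frechet_derivative (\<lambda>w. f w + g w) (at z) v
    = frechet_derivative f (at z) v + frechet_derivative g (at z) v"
  by (rule fd_eqI[OF has_derivative_add[OF assms[unfolded frechet_derivative_works]]])

lemma fd_mult:
  fixes f g :: "'a::real_normed_vector \<Rightarrow> complex"
  assumes "f differentiable at z" "g differentiable at z"
  shows "frechet_derivative (\<lambda>w. f w * g w) (at z) v
    = f z * frechet_derivative g (at z) v + frechet_derivative f (at z) v * g z"
  by (rule fd_eqI[OF has_derivative_mult[OF assms[unfolded frechet_derivative_works]]])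

lemma differentiable_bounded_linear:
  assumes "bounded_linear L" "f differentiable at z"
  shows "(\<lambda>w. L (f w)) differentiable at z"
  by (rule differentiableI[OF bounded_linear.has_derivative[OF assms(1) assms(2)[unfolded frechet_derivative_works]]])

lemma fd_cnj:
  "f differentiable at z \<Longrightarrow> frechet_derivative (\<lambda>w. cnj (f w)) (at z) v = cnj (frechet_derivative f (at z) v)"
  by (rule fd_bounded_linear[OF bounded_linear_cnj])

lemma wirt_const [simp]: "wirt i (\<lambda>w. c) z = 0" "wirt_bar i (\<lambda>w. c) z = 0"
  by (simp_all add: wirt_def wirt_bar_def)

lemma wirt_add:
  assumes "f differentiable at z" "g differentiable at z"
  shows "wirt i (\<lambda>w. f w + g w) z = wirt i f z + wirt i g z"
    "wirt_bar i (\<lambda>w. f w + g w) z = wirt_bar i f z + wirt_bar i g z"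
  by (simp_all add: wirt_def wirt_bar_def fd_add[OF assms] field_simps)

lemma wirt_mult:
  assumes "f differentiable at z" "g differentiable at z"
  shows "wirt i (\<lambda>w. f w * g w) z = f z * wirt i g z + wirt i f z * g z"
    "wirt_bar i (\<lambda>w. f w * g w) z = f z * wirt_bar i g z + wirt_bar i f z * g z"
  by (simp_all add: wirt_def wirt_bar_def fd_mult[OF assms] field_simps)

lemma wirt_lincomb:
  assumes "f differentiable at z" "g differentiable at z"
  shows "wirt i (\<lambda>w. a * f w + b * g w) z = a * wirt i f z + b * wirt i g z"
    "wirt_bar i (\<lambda>w. a * f w + b * g w) z = a * wirt_bar i f z + b * wirt_bar i g z"
  using assms by (simp_all add: wirt_add wirt_mult)

lemma wirt_sum:
  assumes "\<And>a. a \<in> S \<Longrightarrow> f a differentiable at z"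
  shows "wirt i (\<lambda>w. \<Sum>a\<in>S. f a w) z = (\<Sum>a\<in>S. wirt i (f a) z)"
    "wirt_bar i (\<lambda>w. \<Sum>a\<in>S. f a w) z = (\<Sum>a\<in>S. wirt_bar i (f a) z)"
  using assms
  by (induction S rule: infinite_finite_induct) (simp_all add: wirt_add differentiable_sum)

lemma wirt_cnj:
  assumes "f differentiable at z"
  shows "wirt i (\<lambda>w. cnj (f w)) z = cnj (wirt_bar i f z)"
    "wirt_bar i (\<lambda>w. cnj (f w)) z = cnj (wirt i f z)"
  by (simp_all add: wirt_def wirt_bar_def fd_cnj[OF assms] field_simps)

text \<open>Formulas for first derivatives are available only on an open set; this allows them to be
  differentiated once more.\<close>

lemma wirt_cong:
  assumes "f differentiable at z" "open W" "z \<in> W" "\<And>w. w \<in> W \<Longrightarrow> f w = g w"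
  shows "wirt i f z = wirt i g z" "wirt_bar i f z = wirt_bar i g z"
proof -
  have "frechet_derivative f (at z) = frechet_derivative g (at z)"
    using assms by (intro frechet_derivative_transform_within_open) auto
  then show "wirt i f z = wirt i g z" "wirt_bar i f z = wirt_bar i g z"
    by (simp_all add: wirt_def wirt_bar_def)
qed

lemma wirt_coordinate:
  "wirt i (\<lambda>w. w $ k) z = (if i = k then 1 else 0)" "wirt_bar i (\<lambda>w. w $ k) z = 0"
proof -
  have "frechet_derivative (\<lambda>w :: complex ^ 'a. w $ k) (at z) v = v $ k" for v
    by (rule fd_eqI[OF bounded_linear_imp_has_derivative[OF bounded_linear_vec_nth]])
  then show "wirt i (\<lambda>w. w $ k) z = (if i = k then 1 else 0)" "wirt_bar i (\<lambda>w. w $ k) z = 0"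
    by (auto simp: wirt_def wirt_bar_def axis_def)
qed

section \<open>Functions with pointwise second derivatives\<close>

definition twice_differentiable_on ::
  "'a::real_normed_vector set \<Rightarrow> ('a \<Rightarrow> 'b::real_normed_vector) \<Rightarrow> bool" where
  "twice_differentiable_on W f \<longleftrightarrow> (\<forall>x\<in>W. f differentiable at x) \<and>
     (\<forall>v. \<forall>x\<in>W. (\<lambda>y. frechet_derivative f (at y) v) differentiable at x)"

lemma twice_differentiable_onD:
  assumes "twice_differentiable_on W f" "x \<in> W"
  shows "f differentiable at x" "(\<lambda>y. frechet_derivative f (at y) v) differentiable at x"
  using assms by (auto simp: twice_differentiable_on_def)

text \<open>On the open set \<open>W\<close> the derivative in direction \<open>v\<close> agrees
  with \<open>g v\<close>, so it inherits the differentiability of \<open>g v\<close>. The closure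
  rules below then follow from explicit formulas for the first derivative.\<close>

lemma twice_differentiable_onI:
  assumes "open W" "\<And>x. x \<in> W \<Longrightarrow> f differentiable at x"
    and "\<And>x v. x \<in> W \<Longrightarrow> frechet_derivative f (at x) v = g v x"
    and "\<And>x v. x \<in> W \<Longrightarrow> g v differentiable at x"
  shows "twice_differentiable_on W f"
proof -
  have "(\<lambda>y. frechet_derivative f (at y) v) differentiable at x" if x: "x \<in> W" for v x
  proof -
    obtain D where "(g v has_derivative D) (at x)"
      using assms(4)[OF x] by (auto simp: differentiable_def)
    then have "((\<lambda>y. frechet_derivative f (at y) v) has_derivative D) (at x)"
      by (rule has_derivative_transform_within_open[OF _ assms(1) x]) (simp add: assms(3))
    then show ?thesis by (rule differentiableI)
  qed
  then show ?thesis using assms(2) by (simp add: twice_differentiable_on_def)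
qed

lemma smooth_on_imp_twice_differentiable_on:
  assumes "smooth_on W f"
  shows "twice_differentiable_on W f"
proof -
  have "Ck_on (Suc (Suc 0)) W f"
    using assms by (simp add: smooth_on_def del: Ck_on.simps)
  then show ?thesis by (auto simp: twice_differentiable_on_def)
qed

lemma twice_differentiable_on_const: "twice_differentiable_on W (\<lambda>x. c)"
  by (simp add: twice_differentiable_on_def)

lemma twice_differentiable_on_add:
  assumes "open W" "twice_differentiable_on W f" "twice_differentiable_on W g"
  shows "twice_differentiable_on W (\<lambda>x. f x + g x)"
  using assms(2,3)
  by (intro twice_differentiable_onI[OF assms(1),
        where g = "\<lambda>v x. frechet_derivative f (at x) v + frechet_derivative g (at x) v"])
     (auto simp: twice_differentiable_on_def fd_add)

lemma twice_differentiable_on_mult: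
  fixes f g :: "'a::real_normed_vector \<Rightarrow> complex"
  assumes "open W" "twice_differentiable_on W f" "twice_differentiable_on W g"
  shows "twice_differentiable_on W (\<lambda>x. f x * g x)"
  using assms(2,3)
  by (intro twice_differentiable_onI[OF assms(1),
        where g = "\<lambda>v x. f x * frechet_derivative g (at x) v + frechet_derivative f (at x) v * g x"])
     (auto simp: twice_differentiable_on_def fd_mult)

lemma twice_differentiable_on_sum:
  assumes "open W" "\<And>a. a \<in> S \<Longrightarrow> twice_differentiable_on W (f a)"
  shows "twice_differentiable_on W (\<lambda>x. \<Sum>a\<in>S. f a x)"
  using assms
  by (induction S rule: infinite_finite_induct)
     (simp_all add: twice_differentiable_on_add twice_differentiable_on_const)

lemma twice_differentiable_on_bounded_linear:
  assumes "open W" "bounded_linear L" "twice_differentiable_on W f"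
  shows "twice_differentiable_on W (\<lambda>x. L (f x))"
proof (rule twice_differentiable_onI[OF assms(1), where g = "\<lambda>v x. L (frechet_derivative f (at x) v)"])
  show "(\<lambda>x. L (f x)) differentiable at x" "(\<lambda>x. L (frechet_derivative f (at x) v)) differentiable at x"
    if "x \<in> W" for x v
    using twice_differentiable_onD[OF assms(3) that] by (auto intro!: differentiable_bounded_linear[OF assms(2)])
  show "frechet_derivative (\<lambda>x. L (f x)) (at x) v = L (frechet_derivative f (at x) v)" if "x \<in> W" for x v
    by (rule fd_bounded_linear[OF assms(2) twice_differentiable_onD(1)[OF assms(3) that]])
qed

lemma twice_differentiable_on_ident: "twice_differentiable_on W (\<lambda>x. x)"
  by (simp add: twice_differentiable_on_def)

lemma differentiable_wirt:
  assumes "twice_differentiable_on W f" "x \<in> W"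
  shows "wirt i f differentiable at x" "wirt_bar i f differentiable at x"
  unfolding wirt_def[abs_def] wirt_bar_def[abs_def]
  using twice_differentiable_onD[OF assms]
  by (auto intro!: differentiable_add differentiable_diff differentiable_mult)

text \<open>If \<open>D\<close> were negative, \<open>f'\<close>, which vanishes at the minimum 0,
  would be negative just to the right of 0, and the mean value theorem would give a value of
  \<open>f\<close> below \<open>f 0\<close>.\<close>

lemma second_derivative_nonneg:
  fixes f f' :: "real \<Rightarrow> real"
  assumes "d > 0" and f': "\<And>t. \<bar>t\<bar> < d \<Longrightarrow> (f has_real_derivative f' t) (at t)"
    and f'': "(f' has_real_derivative D) (at 0)"
    and min: "\<And>t. \<bar>t\<bar> < d \<Longrightarrow> f 0 \<le> f t"
  shows "0 \<le> D"
proof (rule ccontr)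
  assume "\<not> 0 \<le> D"
  have "f' 0 = 0"
    using DERIV_local_min[OF f'[of 0] assms(1)] min assms(1) by simp
  then obtain e where e: "e > 0" "\<And>t. 0 < t \<Longrightarrow> t < e \<Longrightarrow> f' t < 0"
    using DERIV_neg_dec_right[OF f''] \<open>\<not> 0 \<le> D\<close> by auto
  define t where "t = min d e / 2"
  have t: "0 < t" "t < d" "t < e"
    using assms(1) e(1) by (auto simp: t_def min_def)
  obtain s where "0 < s" "s < t" "f t - f 0 = (t - 0) * f' s"
    using MVT2[OF t(1), of f f'] f' t by auto
  moreover have "f' s < 0"
    using e(2)[of s] t calculation by simp
  ultimately have "f t < f 0"
    using t by (smt (verit) mult_pos_neg)
  with min[of t] t show False by simp
qed

text \<open>With \<open>D\<^sub>v\<close> the derivative in the real direction \<open>v\<close>, the Levi form of \<open>F\<close> at \<open>v\<close> is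
  \<open>(D\<^sub>v + \<i> D\<^bsub>\<i>v\<^esub>)(D\<^sub>v - \<i> D\<^bsub>\<i>v\<^esub>) F / 4\<close>, and the cross terms are purely imaginary for real \<open>F\<close>.\<close>

lemma levi_form_nonneg:
  fixes F :: "complex ^ 'n::finite \<Rightarrow> complex"
  assumes "open W" "z \<in> W" and F: "twice_differentiable_on W F"
    and real: "\<And>w. w \<in> W \<Longrightarrow> Im (F w) = 0" and min: "\<And>w. w \<in> W \<Longrightarrow> Re (F z) \<le> Re (F w)"
  shows "0 \<le> Re (sesq (\<chi> i j. wirt_bar j (wirt i F) z) v v)"
proof -
  define D where "D u = (\<lambda>w. frechet_derivative F (at w) u)" for u
  define DD where "DD a b = frechet_derivative (D a) (at z) b" for a b
  have Ddiff: "D u differentiable at w" if "w \<in> W" for u w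
    using twice_differentiable_onD(2)[OF F that] by (simp add: D_def)
  have linD: "linear (\<lambda>u. D u w)" if "w \<in> W" for w
    unfolding D_def using linear_frechet_derivative twice_differentiable_onD(1)[OF F that] by blast
  have linDD: "linear (DD a)" for a
    unfolding DD_def[abs_def] using linear_frechet_derivative Ddiff[OF assms(2)] by blast
  \<comment> \<open>\<open>F\<close> is real on \<open>W\<close>, hence so are its directional
    derivatives; \<open>ImDD\<close> repeats the argument for the second derivatives.\<close>
  have ImD: "Im (D u w) = 0" if "w \<in> W" for u w
  proof -
    have "Im (D u w) = frechet_derivative (\<lambda>w. Im (F w)) (at w) u"
      unfolding D_def using twice_differentiable_onD(1)[OF F that]
      by (rule fd_bounded_linear[OF bounded_linear_Im, symmetric])
    also have "frechet_derivative (\<lambda>w. Im (F w)) (at w) = frechet_derivative (\<lambda>w. 0) (at w)"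
      using twice_differentiable_onD(1)[OF F that] that assms(1) real
      by (intro frechet_derivative_transform_within_open[where X = W])
         (auto intro!: differentiable_bounded_linear[OF bounded_linear_Im])
    finally show ?thesis by simp
  qed
  have ImDD: "Im (DD a b) = 0" for a b
  proof -
    have "Im (DD a b) = frechet_derivative (\<lambda>w. Im (D a w)) (at z) b"
      unfolding DD_def using Ddiff[OF assms(2)]
      by (rule fd_bounded_linear[OF bounded_linear_Im, symmetric])
    also have "frechet_derivative (\<lambda>w. Im (D a w)) (at z) = frechet_derivative (\<lambda>w. 0) (at z)"
      using Ddiff[OF assms(2)] assms(1,2) ImD
      by (intro frechet_derivative_transform_within_open[where X = W])
         (auto intro!: differentiable_bounded_linear[OF bounded_linear_Im])
    finally show ?thesis by simp
  qed
  \<comment> \<open>The second derivative test on the real line through \<open>z\<close> in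
    direction \<open>u\<close>.\<close>
  have line: "0 \<le> Re (DD u u)" for u
  proof -
    have "continuous_on UNIV (\<lambda>t::real. z + t *\<^sub>R u)"
      by (intro continuous_intros)
    then have "open ((\<lambda>t::real. z + t *\<^sub>R u) -` W)"
      using assms(1) by (simp add: open_vimage continuous_on_eq_continuous_within)
    then obtain d where d: "d > 0" "\<And>t::real. \<bar>t\<bar> < d \<Longrightarrow> z + t *\<^sub>R u \<in> W"
      using assms(2) unfolding open_dist by (auto simp: dist_real_def dest!: bspec[where x = 0])
    have der: "((\<lambda>t::real. Re (G (z + t *\<^sub>R u))) has_real_derivative Re (frechet_derivative G (at (z + t *\<^sub>R u)) u)) (at t)"
      if "G differentiable at (z + t *\<^sub>R u)" for G :: "complex ^ 'n \<Rightarrow> complex" and t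
    proof -
      have G: "(G has_derivative frechet_derivative G (at (z + t *\<^sub>R u))) (at (z + t *\<^sub>R u))"
        using that by (simp add: frechet_derivative_works)
      have "((\<lambda>t::real. z + t *\<^sub>R u) has_derivative (\<lambda>s. s *\<^sub>R u)) (at t)"
        by (auto intro!: derivative_eq_intros)
      from has_derivative_compose[OF this G]
      have "((\<lambda>t. Re (G (z + t *\<^sub>R u))) has_derivative (\<lambda>s. Re (frechet_derivative G (at (z + t *\<^sub>R u)) (s *\<^sub>R u)))) (at t)"
        by (rule bounded_linear.has_derivative[OF bounded_linear_Re])
      then show ?thesis
        by (simp add: has_field_derivative_def linear_cmul[OF linear_frechet_derivative[OF that]] mult_commute_abs)
    qed
    show ?thesis
    proof (rule second_derivative_nonneg[OF d(1)])
      show "((\<lambda>t. Re (F (z + t *\<^sub>R u))) has_real_derivative Re (D u (z + t *\<^sub>R u))) (at t)" if "\<bar>t\<bar> < d" for t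
        using der[of F t] twice_differentiable_onD(1)[OF F d(2)[OF that]] by (simp add: D_def)
      show "((\<lambda>t. Re (D u (z + t *\<^sub>R u))) has_real_derivative Re (DD u u)) (at 0)"
        using der[of "D u" 0] Ddiff[OF assms(2)] by (simp add: DD_def)
      show "Re (F (z + 0 *\<^sub>R u)) \<le> Re (F (z + t *\<^sub>R u))" if "\<bar>t\<bar> < d" for t
        using min d(2)[OF that] by simp
    qed
  qed
  \<comment> \<open>\<open>v\<close> and \<open>\<i> *s v\<close> in the real basis of the vectors
    \<open>axis i 1\<close> and \<open>axis i \<i>\<close>. With these, \<open>expand\<close> turns
    contracted Wirtinger sums of a real linear \<open>l\<close> into the values of \<open>l\<close>
    at \<open>v\<close> and \<open>\<i> *s v\<close>.\<close>
  have v: "(\<Sum>i\<in>UNIV. Re (v$i) *\<^sub>R axis i 1 + Im (v$i) *\<^sub>R axis i \<i>) = v"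
    by (simp add: vec_eq_iff axis_def sum.distrib sum_subtractf complex_eq_iff if_distrib if_distribR cong: if_cong)
  have iv: "(\<Sum>i\<in>UNIV. Re (v$i) *\<^sub>R axis i \<i> - Im (v$i) *\<^sub>R axis i 1) = \<i> *s v"
    by (simp add: vec_eq_iff axis_def sum.distrib sum_subtractf complex_eq_iff if_distrib if_distribR cong: if_cong)
  have expand: "(\<Sum>i\<in>UNIV. v$i * (l (axis i 1) - \<i> * l (axis i \<i>))) = l v - \<i> * l (\<i> *s v)"
      "(\<Sum>i\<in>UNIV. cnj (v$i) * (l (axis i 1) + \<i> * l (axis i \<i>))) = l v + \<i> * l (\<i> *s v)"
    if "linear l" for l :: "complex ^ 'n \<Rightarrow> complex"
  proof -
    have 1: "l v = (\<Sum>i\<in>UNIV. Re (v$i) * l (axis i 1) + Im (v$i) * l (axis i \<i>))"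
      by (subst v[symmetric]) (simp add: linear_sum[OF that] linear_add[OF that] linear_cmul[OF that] scaleR_conv_of_real[where 'a = complex])
    have 2: "l (\<i> *s v) = (\<Sum>i\<in>UNIV. Re (v$i) * l (axis i \<i>) - Im (v$i) * l (axis i 1))"
      by (subst iv[symmetric]) (simp add: linear_sum[OF that] linear_diff[OF that] linear_cmul[OF that] scaleR_conv_of_real[where 'a = complex])
    show "(\<Sum>i\<in>UNIV. v$i * (l (axis i 1) - \<i> * l (axis i \<i>))) = l v - \<i> * l (\<i> *s v)"
      unfolding 1 2 sum_distrib_left sum_subtractf[symmetric]
      by (intro sum.cong refl) (simp add: complex_eq_iff algebra_simps)
    show "(\<Sum>i\<in>UNIV. cnj (v$i) * (l (axis i 1) + \<i> * l (axis i \<i>))) = l v + \<i> * l (\<i> *s v)"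
      unfolding 1 2 sum_distrib_left sum.distrib[symmetric]
      by (intro sum.cong refl) (simp add: complex_eq_iff algebra_simps)
  qed
  \<comment> \<open>The holomorphic derivative of \<open>F\<close> contracted with \<open>v\<close>.
    On \<open>W\<close> the first part of \<open>expand\<close> rewrites it by real directional
    derivatives; the second part treats the antiholomorphic derivative of \<open>G\<close>.\<close>
  define G where "G w = (\<Sum>i\<in>UNIV. v$i * wirt i F w)" for w
  have wd: "wirt i F differentiable at z" for i
    using differentiable_wirt[OF F assms(2)] by blast
  have "sesq (\<chi> i j. wirt_bar j (wirt i F) z) v v = (\<Sum>j\<in>UNIV. \<Sum>i\<in>UNIV. wirt_bar j (wirt i F) z * v$i * cnj (v$j))"
    unfolding sesq_def vec_lambda_beta by (rule sum.swap)
  also have "\<dots> = (\<Sum>j\<in>UNIV. cnj (v$j) * wirt_bar j G z)"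
    unfolding G_def by (simp add: wirt_sum wirt_mult wd sum_distrib_left mult_ac)
  also have "\<dots> = (fd G z v + \<i> * fd G z (\<i> *s v)) / 2"
  proof -
    have "G differentiable at z"
      unfolding G_def by (intro differentiable_sum differentiable_mult) (auto simp: wd)
    from expand(2)[OF linear_frechet_derivative[OF this]] show ?thesis
      by (simp add: wirt_bar_def sum_divide_distrib[symmetric])
  qed
  finally have 1: "sesq (\<chi> i j. wirt_bar j (wirt i F) z) v v = (fd G z v + \<i> * fd G z (\<i> *s v)) / 2" .
  have 2: "fd G z = fd (\<lambda>w. (D v w - \<i> * D (\<i> *s v) w) / 2) z"
  proof (rule frechet_derivative_transform_within_open[OF _ assms(1,2)])
    show "G differentiable at z"
      unfolding G_def by (intro differentiable_sum differentiable_mult) (auto simp: wd)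
    show "G w = (D v w - \<i> * D (\<i> *s v) w) / 2" if "w \<in> W" for w
      using expand(1)[OF linD[OF that]]
      by (simp add: G_def wirt_def D_def sum_divide_distrib[symmetric])
  qed
  have 3: "fd (\<lambda>w. (D v w - \<i> * D (\<i> *s v) w) / 2) z u = (DD v u - \<i> * DD (\<i> *s v) u) / 2" for u
  proof (rule fd_eqI)
    have *: "(D a has_derivative DD a) (at z)" for a
      using Ddiff[OF assms(2)] by (simp add: frechet_derivative_works DD_def[abs_def])
    show "((\<lambda>w. (D v w - \<i> * D (\<i> *s v) w) / 2) has_derivative (\<lambda>u. (DD v u - \<i> * DD (\<i> *s v) u) / 2)) (at z)"
      by (auto intro!: derivative_eq_intros * simp: field_simps)
  qed
  have "Re (sesq (\<chi> i j. wirt_bar j (wirt i F) z) v v) = (Re (DD v v) + Re (DD (\<i> *s v) (\<i> *s v))) / 4"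
    unfolding 1 2 3 by (simp add: ImDD)
  then show ?thesis using line[of v] line[of "\<i> *s v"] by simp
qed


section \<open>The Chern curvature at a maximum of the quotient of two metrics\<close>

lemma differentiable_prod:
  fixes f :: "'i \<Rightarrow> 'a::real_normed_vector \<Rightarrow> complex"
  assumes "\<And>i. i \<in> S \<Longrightarrow> f i differentiable at z"
  shows "(\<lambda>w. \<Prod>i\<in>S. f i w) differentiable at z"
  using assms by (induction S rule: infinite_finite_induct) simp_all

lemma differentiable_det:
  fixes A :: "'a::real_normed_vector \<Rightarrow> complex ^ 'r ^ 'r::finite"
  assumes "\<And>i j. (\<lambda>w. A w $ i $ j) differentiable at z"
  shows "(\<lambda>w. det (A w)) differentiable at z"
  unfolding det_def
  by (rule differentiable_sum)
     (simp_all add: finite_permutations differentiable_prod assms)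

text \<open>Column \<open>j\<close> of the inverse solves \<open>A *v x = axis j 1\<close>, so
  Cramer's rule applies.\<close>

lemma matrix_inv_cramer:
  fixes A :: "complex ^ 'r ^ 'r::finite"
  assumes "invertible A"
  shows "matrix_inv A $ k $ j = det (\<chi> i l. if l = k then axis j 1 $ i else A $ i $ l) / det A"
proof -
  have "A *v column j (matrix_inv A) = axis j 1"
    using matrix_inv_right_left(1)[OF assms]
    by (simp add: vec_eq_iff matrix_matrix_mult_def matrix_vector_mult_def column_def mat_def axis_def)
  moreover have "det A \<noteq> 0"
    using assms by (simp add: invertible_det_nz)
  ultimately have "column j (matrix_inv A) = (\<chi> k. det (\<chi> i l. if l = k then axis j 1 $ i else A $ i $ l) / det A)"
    by (simp add: cramer)
  then have "column j (matrix_inv A) $ k = (\<chi> k. det (\<chi> i l. if l = k then axis j 1 $ i else A $ i $ l) / det A) $ k"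
    by (rule arg_cong)
  then show ?thesis
    by (simp add: column_def)
qed

text \<open>By Cramer's rule the entries are, throughout \<open>W\<close>, quotients of determinants
  with nonzero denominator. This makes the Chern connection differentiable, as the curvature
  requires.\<close>

lemma differentiable_matrix_inv:
  fixes A :: "'a::real_normed_vector \<Rightarrow> complex ^ 'r ^ 'r::finite"
  assumes "open W" "z \<in> W" and inv: "\<And>w. w \<in> W \<Longrightarrow> invertible (A w)"
    and A: "\<And>i j. (\<lambda>w. A w $ i $ j) differentiable at z"
  shows "(\<lambda>w. matrix_inv (A w) $ k $ j) differentiable at z"
proof -
  let ?f = "\<lambda>w. det (\<chi> i l. if l = k then axis j 1 $ i else A w $ i $ l) / det (A w)"
  have "?f differentiable at z"
  proof (intro differentiable_divide differentiable_det A)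
    show "(\<lambda>w. (\<chi> i l. if l = k then axis j 1 $ i else A w $ i $ l) $ i $ l) differentiable at z" for i l
      using A by (cases "l = k") simp_all
    show "det (A z) \<noteq> 0"
      using inv[OF assms(2)] by (simp add: invertible_det_nz)
  qed
  then obtain D where "(?f has_derivative D) (at z)"
    by (auto simp: differentiable_def)
  then have "((\<lambda>w. matrix_inv (A w) $ k $ j) has_derivative D) (at z)"
    by (rule has_derivative_transform_within_open[OF _ assms(1,2)]) (simp add: matrix_inv_cramer inv)
  then show ?thesis by (rule differentiableI)
qed

text \<open>As \<open>H\<close> is Hermitian, its antiholomorphic derivative is the adjoint of the
  holomorphic one, which is \<open>chern_conn H j z ** H z\<close>.\<close>

lemma wirt_bar_hermitian:
  fixes H :: "complex ^ 'n::finite \<Rightarrow> complex ^ 'r ^ 'r::finite"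
  assumes "open W" "z \<in> W"
    and Hd: "\<And>\<alpha> \<beta>. (\<lambda>w. H w $ \<alpha> $ \<beta>) differentiable at z"
    and her: "\<And>w. w \<in> W \<Longrightarrow> hermitian_matrix (H w)"
    and inv: "invertible (H z)"
  shows "wirt_bar j (\<lambda>w. H w $ \<gamma> $ \<beta>) z = (H z ** adjoint_matrix (chern_conn H j z)) $ \<gamma> $ \<beta>"
proof -
  have "wirt_bar j (\<lambda>w. H w $ \<gamma> $ \<beta>) z = cnj (wirt j (\<lambda>w. cnj (H w $ \<gamma> $ \<beta>)) z)"
    by (simp add: wirt_cnj Hd)
  also have "wirt j (\<lambda>w. cnj (H w $ \<gamma> $ \<beta>)) z = wirt j (\<lambda>w. H w $ \<beta> $ \<gamma>) z"
    by (rule wirt_cong(1)[OF _ assms(1,2)])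
       (simp_all add: hermitian_matrixD[OF her] differentiable_bounded_linear[OF bounded_linear_cnj Hd])
  also have "cnj \<dots> = adjoint_matrix (wirt_matrix j H z) $ \<gamma> $ \<beta>"
    by (simp add: adjoint_matrix_def wirt_matrix_def)
  also have "adjoint_matrix (wirt_matrix j H z) = H z ** adjoint_matrix (chern_conn H j z)"
    using her[OF assms(2)] chern_conn_unique[where H = H and z = z, OF inv, of j "chern_conn H j z"]
      by (simp add: adjoint_matrix_mult hermitian_matrix_adjoint)
  finally show ?thesis .
qed

text \<open>Apply the antiholomorphic derivative to the compatibility relation
  \<open>wirt_matrix i H w = chern_conn H i w ** H w\<close>, valid on \<open>W\<close>. The product
  rule gives minus the curvature plus the connection times the derivative from
  \<open>wirt_bar_hermitian\<close>.\<close>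

lemma chern_curv_eq:
  fixes H :: "complex ^ 'n::finite \<Rightarrow> complex ^ 'r ^ 'r::finite"
  assumes "open W" "z \<in> W"
    and H: "\<And>\<alpha> \<beta>. twice_differentiable_on W (\<lambda>w. H w $ \<alpha> $ \<beta>)"
    and her: "\<And>w. w \<in> W \<Longrightarrow> hermitian_matrix (H w)"
    and inv: "\<And>w. w \<in> W \<Longrightarrow> invertible (H w)"
  shows "chern_curv H i j z = chern_conn H i z ** (H z ** adjoint_matrix (chern_conn H j z))
     - (\<chi> \<alpha> \<beta>. wirt_bar j (wirt i (\<lambda>w. H w $ \<alpha> $ \<beta>)) z)"
proof -
  note Hd = twice_differentiable_onD(1)[OF H assms(2)]
  have conn: "wirt_matrix k H w = chern_conn H k w ** H w" if "w \<in> W" for k w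
    using chern_conn_unique[where H = H and z = w, OF inv[OF that], of k "chern_conn H k w"] by simp
  have conn_diff: "(\<lambda>w. chern_conn H i w $ \<alpha> $ \<gamma>) differentiable at z" for \<alpha> \<gamma>
    unfolding chern_conn_def matrix_matrix_mult_def wirt_matrix_def vec_lambda_beta
    using differentiable_matrix_inv[OF assms(1,2) inv Hd] differentiable_wirt(1)[OF H assms(2)]
    by (intro differentiable_sum ballI differentiable_mult) auto
  have bar: "wirt_bar j (\<lambda>w. H w $ \<gamma> $ \<beta>) z = (H z ** adjoint_matrix (chern_conn H j z)) $ \<gamma> $ \<beta>" for \<gamma> \<beta>
    by (rule wirt_bar_hermitian[where H = H, OF assms(1,2) Hd her inv[OF assms(2)]])
  have "wirt_bar j (wirt i (\<lambda>w. H w $ \<alpha> $ \<beta>)) z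
      = (chern_conn H i z ** (H z ** adjoint_matrix (chern_conn H j z))) $ \<alpha> $ \<beta> - chern_curv H i j z $ \<alpha> $ \<beta>" for \<alpha> \<beta>
  proof -
    have "wirt_bar j (wirt i (\<lambda>w. H w $ \<alpha> $ \<beta>)) z
        = wirt_bar j (\<lambda>w. \<Sum>\<gamma>\<in>UNIV. chern_conn H i w $ \<alpha> $ \<gamma> * H w $ \<gamma> $ \<beta>) z"
    proof (rule wirt_cong(2)[OF _ assms(1,2)])
      show "wirt i (\<lambda>w. H w $ \<alpha> $ \<beta>) differentiable at z"
        by (rule differentiable_wirt(1)[OF H assms(2)])
      show "wirt i (\<lambda>w. H w $ \<alpha> $ \<beta>) w = (\<Sum>\<gamma>\<in>UNIV. chern_conn H i w $ \<alpha> $ \<gamma> * H w $ \<gamma> $ \<beta>)" if "w \<in> W" for w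
        using arg_cong[OF conn[OF that, of i], of "\<lambda>A. A $ \<alpha> $ \<beta>"]
        by (simp add: wirt_matrix_def matrix_matrix_mult_def)
    qed
    also have "\<dots> = (\<Sum>\<gamma>\<in>UNIV. chern_conn H i z $ \<alpha> $ \<gamma> * wirt_bar j (\<lambda>w. H w $ \<gamma> $ \<beta>) z
         + wirt_bar j (\<lambda>w. chern_conn H i w $ \<alpha> $ \<gamma>) z * H z $ \<gamma> $ \<beta>)"
      by (simp add: wirt_sum wirt_mult conn_diff Hd)
    also have "\<dots> = (chern_conn H i z ** (H z ** adjoint_matrix (chern_conn H j z))) $ \<alpha> $ \<beta> - chern_curv H i j z $ \<alpha> $ \<beta>"
      unfolding bar chern_curv_def chern_curv_endo_def matrix_matrix_mult_def[of "chern_conn H i z"]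
        matrix_matrix_mult_def[of _ "H z"]
      by (simp add: sum.distrib sum_negf)
    finally show ?thesis .
  qed
  then show ?thesis
    by (simp add: vec_eq_iff)
qed

text \<open>These are the components of a holomorphic section with value \<open>u\<close> at
  \<open>z\<close> and freely prescribed first derivatives \<open>q\<close>, affine in the
  coordinates.\<close>

lemma affine_section:
  fixes q :: "'n::finite \<Rightarrow> complex ^ 'r::finite"
  shows "open W \<Longrightarrow> twice_differentiable_on W (\<lambda>w. (u + (\<Sum>k\<in>UNIV. (w $ k - z $ k) *s q k)) $ \<alpha>)"
    and "(\<lambda>w. (u + (\<Sum>k\<in>UNIV. (w $ k - z $ k) *s q k)) $ \<alpha>) differentiable at x"
    and "wirt i (\<lambda>w. (u + (\<Sum>k\<in>UNIV. (w $ k - z $ k) *s q k)) $ \<alpha>) x = q i $ \<alpha>"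
    and "wirt_bar i (\<lambda>w. (u + (\<Sum>k\<in>UNIV. (w $ k - z $ k) *s q k)) $ \<alpha>) x = 0"
proof -
  define c where "c = u $ \<alpha> - (\<Sum>k\<in>UNIV. z $ k * q k $ \<alpha>)"
  have s: "(\<lambda>w. (u + (\<Sum>k\<in>UNIV. (w $ k - z $ k) *s q k)) $ \<alpha>) = (\<lambda>w. c + (\<Sum>k\<in>UNIV. w $ k * q k $ \<alpha>))"
    by (simp add: c_def algebra_simps sum_subtractf sum.distrib)
  have d: "(\<lambda>w :: complex ^ 'n. w $ k) differentiable at x" for k x
    by (rule differentiable_bounded_linear[OF bounded_linear_vec_nth]) simp
  have d2: "(\<lambda>w :: complex ^ 'n. \<Sum>k\<in>UNIV. w $ k * q k $ \<alpha>) differentiable at x"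
    by (intro differentiable_sum ballI differentiable_mult) (simp_all add: d)
  show "twice_differentiable_on W (\<lambda>w. (u + (\<Sum>k\<in>UNIV. (w $ k - z $ k) *s q k)) $ \<alpha>)" if "open W"
    unfolding s using that
    by (intro twice_differentiable_on_add twice_differentiable_on_const twice_differentiable_on_sum twice_differentiable_on_mult
          twice_differentiable_on_bounded_linear[OF _ bounded_linear_vec_nth twice_differentiable_on_ident])
  show "(\<lambda>w. (u + (\<Sum>k\<in>UNIV. (w $ k - z $ k) *s q k)) $ \<alpha>) differentiable at x"
    unfolding s by (intro differentiable_add d2) simp
  have "(\<Sum>k\<in>UNIV. (if i = k then 1 else 0) * q k $ \<alpha>) = q i $ \<alpha>"
    by (simp add: mult_delta_left)
  then show "wirt i (\<lambda>w. (u + (\<Sum>k\<in>UNIV. (w $ k - z $ k) *s q k)) $ \<alpha>) x = q i $ \<alpha>"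
    "wirt_bar i (\<lambda>w. (u + (\<Sum>k\<in>UNIV. (w $ k - z $ k) *s q k)) $ \<alpha>) x = 0"
    unfolding s by (simp_all add: wirt_add wirt_sum wirt_mult d d2 wirt_coordinate)
qed

lemma twice_differentiable_on_sesq:
  assumes "open W" "\<And>\<alpha> \<beta>. twice_differentiable_on W (\<lambda>w. H w $ \<alpha> $ \<beta>)"
    and "\<And>\<alpha>. twice_differentiable_on W (\<lambda>w. s w $ \<alpha>)"
  shows "twice_differentiable_on W (\<lambda>w. sesq (H w) (s w) (s w))"
  unfolding sesq_def
  by (intro twice_differentiable_on_sum twice_differentiable_on_mult assms
      twice_differentiable_on_bounded_linear[OF _ bounded_linear_cnj])

text \<open>A Bochner formula: \<open>q i + u v* chern_conn H i z\<close> is the covariant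
  derivative of the holomorphic section \<open>s\<close> at \<open>z\<close>, so the Levi form of
  its squared norm is the Gram matrix of these derivatives minus the curvature.\<close>

lemma wirt_bar_wirt_sesq:
  fixes H :: "complex ^ 'n::finite \<Rightarrow> complex ^ 'r ^ 'r::finite" and q :: "'n \<Rightarrow> complex ^ 'r"
  assumes "open W" "z \<in> W"
    and H: "\<And>\<alpha> \<beta>. twice_differentiable_on W (\<lambda>w. H w $ \<alpha> $ \<beta>)"
    and her: "\<And>w. w \<in> W \<Longrightarrow> hermitian_matrix (H w)"
    and inv: "\<And>w. w \<in> W \<Longrightarrow> invertible (H w)"
    and s: "s = (\<lambda>w. u + (\<Sum>k\<in>UNIV. (w $ k - z $ k) *s q k))"
  shows "wirt_bar j (wirt i (\<lambda>w. sesq (H w) (s w) (s w))) z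
    = sesq (H z) (q i + u v* chern_conn H i z) (q j + u v* chern_conn H j z) - sesq (chern_curv H i j z) u u"
proof -
  have sd: "(\<lambda>w. s w $ \<alpha>) differentiable at x" "(\<lambda>w. cnj (s w $ \<alpha>)) differentiable at x" for \<alpha> x
    unfolding s by (rule affine_section differentiable_bounded_linear[OF bounded_linear_cnj])+
  have ws: "wirt k (\<lambda>w. s w $ \<alpha>) x = q k $ \<alpha>" "wirt_bar k (\<lambda>w. s w $ \<alpha>) x = 0"
    "wirt k (\<lambda>w. cnj (s w $ \<alpha>)) x = 0" "wirt_bar k (\<lambda>w. cnj (s w $ \<alpha>)) x = cnj (q k $ \<alpha>)" for k \<alpha> x
    unfolding wirt_cnj[OF sd(1)] unfolding s affine_section by simp_all
  have sz: "s z = u"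
    by (simp add: s vec_eq_iff)
  note Hd = twice_differentiable_onD(1)[OF H]
  note wHd = differentiable_wirt(1)[OF H assms(2)]
  \<comment> \<open>The product rule without a derivative of \<open>cnj (s w $ \<beta>)\<close>,
    which vanishes because \<open>s\<close> is holomorphic.\<close>
  define F1 where "F1 w = (\<Sum>\<alpha>\<in>UNIV. \<Sum>\<beta>\<in>UNIV. (H w $ \<alpha> $ \<beta> * q i $ \<alpha> + wirt i (\<lambda>w. H w $ \<alpha> $ \<beta>) w * s w $ \<alpha>) * cnj (s w $ \<beta>))" for w
  have F1: "wirt i (\<lambda>w. sesq (H w) (s w) (s w)) w = F1 w" if "w \<in> W" for w
    unfolding sesq_def F1_def
    by (simp add: wirt_sum wirt_mult ws sd Hd[OF that])
  have "wirt_bar j (wirt i (\<lambda>w. sesq (H w) (s w) (s w))) z = wirt_bar j F1 z"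
  proof (rule wirt_cong(2)[OF _ assms(1,2) F1])
    show "wirt i (\<lambda>w. sesq (H w) (s w) (s w)) differentiable at z"
      by (rule differentiable_wirt(1)[OF twice_differentiable_on_sesq[OF assms(1) H] assms(2)])
         (unfold s, rule affine_section(1)[OF assms(1)])
  qed auto
  also have "\<dots> = (\<Sum>\<alpha>\<in>UNIV. \<Sum>\<beta>\<in>UNIV.
        (H z $ \<alpha> $ \<beta> * q i $ \<alpha> + wirt i (\<lambda>w. H w $ \<alpha> $ \<beta>) z * u $ \<alpha>) * cnj (q j $ \<beta>)
      + (wirt_bar j (\<lambda>w. H w $ \<alpha> $ \<beta>) z * q i $ \<alpha> + wirt_bar j (wirt i (\<lambda>w. H w $ \<alpha> $ \<beta>)) z * u $ \<alpha>) * cnj (u $ \<beta>))"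
    unfolding F1_def
    by (simp add: wirt_sum wirt_mult wirt_add ws sd Hd[OF assms(2)] wHd sz)
  also have "\<dots> = sesq (H z) (q i) (q j) + sesq (wirt_matrix i H z) u (q j)
      + sesq (\<chi> \<alpha> \<beta>. wirt_bar j (\<lambda>w. H w $ \<alpha> $ \<beta>) z) (q i) u
      + sesq (\<chi> \<alpha> \<beta>. wirt_bar j (wirt i (\<lambda>w. H w $ \<alpha> $ \<beta>)) z) u u"
    by (simp add: sesq_def wirt_matrix_def sum.distrib algebra_simps)
  also have "wirt_matrix i H z = chern_conn H i z ** H z"
    using chern_conn_unique[where H = H and z = z, OF inv[OF assms(2)], of i "chern_conn H i z"] by simp
  also have "(\<chi> \<alpha> \<beta>. wirt_bar j (\<lambda>w. H w $ \<alpha> $ \<beta>) z) = H z ** adjoint_matrix (chern_conn H j z)"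
    by (simp add: vec_eq_iff wirt_bar_hermitian[where H = H, OF assms(1,2) Hd[OF assms(2)] her inv[OF assms(2)]])
  also have "(\<chi> \<alpha> \<beta>. wirt_bar j (wirt i (\<lambda>w. H w $ \<alpha> $ \<beta>)) z)
      = chern_conn H i z ** (H z ** adjoint_matrix (chern_conn H j z)) - chern_curv H i j z"
    by (simp add: chern_curv_eq[where H = H, OF assms(1,2) H her inv])
  \<comment> \<open>The terms other than the curvature are the four summands of
    \<open>sesq (H z)\<close> at the two covariant derivatives.\<close>
  finally show ?thesis
    unfolding sesq_diff_matrix sesq_matrix_mult_left[of "chern_conn H i z"] sesq_matrix_adjoint_right
    by (simp add: sesq_add_left sesq_add_right)
qed


text \<open>The Levi form of \<open>F\<close> and the Gram matrix of the \<open>p i\<close> are both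
  positive semidefinite, so their traces against \<open>matrix_inv g\<close> are nonnegative. By
  \<open>L\<close> the two matrices add up to the difference of the curvature terms.\<close>

lemma mean_curvature_comparison:
  fixes H H0 :: "complex ^ 'n::finite \<Rightarrow> complex ^ 'r ^ 'r::finite" and mu :: real
  assumes W: "open W" "z \<in> W"
    and H: "\<And>\<alpha> \<beta>. twice_differentiable_on W (\<lambda>w. H w $ \<alpha> $ \<beta>)"
    and H0: "\<And>\<alpha> \<beta>. twice_differentiable_on W (\<lambda>w. H0 w $ \<alpha> $ \<beta>)"
    and pos: "\<And>w. w \<in> W \<Longrightarrow> pos_def_matrix (H w)"
    and pos0: "\<And>w. w \<in> W \<Longrightarrow> pos_def_matrix (H0 w)"
    and g: "pos_def_matrix g"
    and le: "\<And>w v. w \<in> W \<Longrightarrow> Re (sesq (H w) v v) \<le> mu * Re (sesq (H0 w) v v)"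
    and eq: "Re (sesq (H z) u u) = mu * Re (sesq (H0 z) u u)"
  shows "mu * Re (\<Sum>i\<in>UNIV. \<Sum>j\<in>UNIV. matrix_inv g $ j $ i * sesq (chern_curv H0 i j z) u u)
    \<le> Re (\<Sum>i\<in>UNIV. \<Sum>j\<in>UNIV. matrix_inv g $ j $ i * sesq (chern_curv H i j z) u u)"
proof -
  let ?P = "matrix_inv g"
  define q where "q i = - (u v* chern_conn H0 i z)" for i
    \<comment> \<open>makes the \<open>H0\<close>-covariant derivative of \<open>s\<close> vanish at \<open>z\<close>\<close>
  define s where "s = (\<lambda>w. u + (\<Sum>k\<in>UNIV. (w $ k - z $ k) *s q k))"
  define F where "F w = of_real mu * sesq (H0 w) (s w) (s w) + (- 1) * sesq (H w) (s w) (s w)" for w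
  \<comment> \<open>The covariant derivative of \<open>s\<close> at \<open>z\<close> with respect to
    \<open>H\<close>.\<close>
  define p where "p i = q i + u v* chern_conn H i z" for i
  have herm: "hermitian_matrix (H w)" "hermitian_matrix (H0 w)" "invertible (H w)" "invertible (H0 w)"
    if "w \<in> W" for w
    using pos[OF that] pos0[OF that] by (auto simp: pos_def_matrix_invertible) (auto simp: pos_def_matrix_def)
  have twice_s: "twice_differentiable_on W (\<lambda>w. s w $ \<alpha>)" for \<alpha>
    unfolding s_def by (rule affine_section(1)[OF W(1)])
  note twice = twice_differentiable_on_sesq[where H = H and s = s, OF W(1) H twice_s]
  note twice0 = twice_differentiable_on_sesq[where H = H0 and s = s, OF W(1) H0 twice_s]
  note d = twice_differentiable_onD(1)[OF twice] and d0 = twice_differentiable_onD(1)[OF twice0]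
  have twice_F: "twice_differentiable_on W F"
    unfolding F_def
    by (rule twice_differentiable_on_add[OF W(1)
          twice_differentiable_on_mult[OF W(1) twice_differentiable_on_const twice0]
          twice_differentiable_on_mult[OF W(1) twice_differentiable_on_const twice]])
  have sz: "s z = u"
    by (simp add: s_def vec_eq_iff)
  have "0 \<le> Re (sesq (\<chi> i j. wirt_bar j (wirt i F) z) v v)" for v
  proof (rule levi_form_nonneg[OF W twice_F])
    show "Im (F w) = 0" if "w \<in> W" for w
      using herm[OF that] by (simp add: F_def Im_sesq_hermitian)
    \<comment> \<open>\<open>Re (F z)\<close> is zero by \<open>eq\<close>, and \<open>le\<close> at
      the vector \<open>s w\<close> makes \<open>Re (F w)\<close> nonnegative.\<close>
    show "Re (F z) \<le> Re (F w)" if "w \<in> W" for w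
      using le[OF that, of "s w"] eq by (simp add: F_def sz)
  qed
  from trace_prod_nonneg[OF pos_def_matrix_inv[OF g] this]
  have 0: "0 \<le> Re (\<Sum>i\<in>UNIV. \<Sum>j\<in>UNIV. ?P $ j $ i * wirt_bar j (wirt i F) z)"
    by simp
  have L: "wirt_bar j (wirt i F) z = sesq (chern_curv H i j z) u u - of_real mu * sesq (chern_curv H0 i j z) u u
      - sesq (H z) (p i) (p j)" for i j
  proof -
    have "wirt_bar j (wirt i F) z
      = wirt_bar j (\<lambda>w. of_real mu * wirt i (\<lambda>w. sesq (H0 w) (s w) (s w)) w + (- 1) * wirt i (\<lambda>w. sesq (H w) (s w) (s w)) w) z"
      by (rule wirt_cong(2)[OF differentiable_wirt(1)[OF twice_F W(2)] W])
         (unfold F_def[abs_def], rule wirt_lincomb(1)[OF d0 d])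
    also have "\<dots> = of_real mu * wirt_bar j (wirt i (\<lambda>w. sesq (H0 w) (s w) (s w))) z
        + (- 1) * wirt_bar j (wirt i (\<lambda>w. sesq (H w) (s w) (s w))) z"
      by (rule wirt_lincomb(2)[OF differentiable_wirt(1)[OF twice0 W(2)] differentiable_wirt(1)[OF twice W(2)]])
    also have "wirt_bar j (wirt i (\<lambda>w. sesq (H0 w) (s w) (s w))) z = - sesq (chern_curv H0 i j z) u u"
      using wirt_bar_wirt_sesq[where H = H0, OF W H0 herm(2,4) s_def, of j i] by (simp add: q_def)
    also have "wirt_bar j (wirt i (\<lambda>w. sesq (H w) (s w) (s w))) z = sesq (H z) (p i) (p j) - sesq (chern_curv H i j z) u u"
      using wirt_bar_wirt_sesq[where H = H, OF W H herm(1,3) s_def, of j i] by (simp add: p_def)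
    finally show ?thesis by simp
  qed
  have 1: "0 \<le> Re (\<Sum>i\<in>UNIV. \<Sum>j\<in>UNIV. ?P $ j $ i * (sesq (chern_curv H i j z) u u
      - of_real mu * sesq (chern_curv H0 i j z) u u - sesq (H z) (p i) (p j)))"
    using 0 by (simp add: L)
  \<comment> \<open>A Gram matrix: its form at \<open>v\<close> is the form of \<open>H z\<close> at
    the combination of the \<open>p i\<close> with coefficients \<open>v $ i\<close>.\<close>
  have "0 \<le> Re (sesq (\<chi> i j. sesq (H z) (p i) (p j)) v v)" for v
  proof -
    have "sesq (\<chi> i j. sesq (H z) (p i) (p j)) v v
        = sesq (H z) (\<Sum>i\<in>UNIV. v $ i *s p i) (\<Sum>j\<in>UNIV. v $ j *s p j)"
      unfolding sesq_sum_left sesq_sum_right sesq_scale_left sesq_scale_right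
      by (subst sesq_def, subst sum.swap) (simp add: sum_distrib_left mult_ac)
    then show ?thesis
      using pos_def_matrix_sesq_nonneg[OF pos[OF W(2)]] by simp
  qed
  from trace_prod_nonneg[OF pos_def_matrix_inv[OF g] this]
  have 2: "0 \<le> Re (\<Sum>i\<in>UNIV. \<Sum>j\<in>UNIV. ?P $ j $ i * sesq (H z) (p i) (p j))"
    by simp
  have "mu * Re (\<Sum>i\<in>UNIV. \<Sum>j\<in>UNIV. ?P $ j $ i * sesq (chern_curv H0 i j z) u u)
      = Re (\<Sum>i\<in>UNIV. \<Sum>j\<in>UNIV. ?P $ j $ i * (of_real mu * sesq (chern_curv H0 i j z) u u))"
    by (simp add: sum_distrib_left algebra_simps)
  with 1 2 show ?thesis
    by (simp add: right_diff_distrib sum_subtractf)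
qed


section \<open>Charts, trivializations and compactness\<close>

lemma chart_homeo:
  assumes "complex_manifold M" "c \<in> atlas M"
  shows "openin (mtop M) (fst c)" "open (snd c ` fst c)"
    "homeomorphic_map (subtopology (mtop M) (fst c)) (top_of_set (snd c ` fst c)) (snd c)"
  using assms by (auto simp: complex_manifold_def)

lemma chart_param:
  assumes "complex_manifold M" "c \<in> atlas M"
  shows "y \<in> fst c \<Longrightarrow> param c (snd c y) = y"
    and "w \<in> snd c ` S \<Longrightarrow> S \<subseteq> fst c \<Longrightarrow> param c w \<in> S \<and> snd c (param c w) = w"
proof -
  note h = chart_homeo[OF assms]
  have inj: "inj_on (snd c) (fst c)"
    using homeomorphic_imp_injective_map[OF h(3)] openin_subset[OF h(1)]
    by (simp add: Int_absorb1)
  then show "y \<in> fst c \<Longrightarrow> param c (snd c y) = y"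
    by (simp add: param_def)
  then show "w \<in> snd c ` S \<Longrightarrow> S \<subseteq> fst c \<Longrightarrow> param c w \<in> S \<and> snd c (param c w) = w"
    by (auto simp: param_def inv_into_f_f[OF inj])
qed

lemma open_chart_image:
  assumes "complex_manifold M" "c \<in> atlas M" "openin (mtop M) V"
  shows "open (snd c ` (fst c \<inter> V))"
proof -
  note h = chart_homeo[OF assms(1,2)]
  have "openin (subtopology (mtop M) (fst c)) (fst c \<inter> V)"
    using assms(3) by (simp add: openin_subtopology_Int2)
  then have "openin (top_of_set (snd c ` fst c)) (snd c ` (fst c \<inter> V))"
    using homeomorphic_imp_open_map[OF h(3)] by (simp add: open_map_def)
  then show ?thesis
    using h(2) openin_open_trans by blast
qed

section \<open>Trivializations and the components of metrics\<close>

lemma openin_triv: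
  assumes "holomorphic_vector_bundle M E" "t \<in> trivs E"
  shows "openin (mtop M) (fst t)"
  using assms unfolding holomorphic_vector_bundle_def by (cases t) fastforce

lemma triv_surj:
  assumes "holomorphic_vector_bundle M E" "t \<in> trivs E" "x \<in> fst t"
  shows "\<exists>v\<in>fibre E x. snd t v = a"
proof -
  define S where "S = {u \<in> topspace (etop E). proj E u \<in> fst t}"
  have hom: "homeomorphic_map (subtopology (etop E) S)
      (prod_topology (subtopology (mtop M) (fst t)) euclidean) (\<lambda>u. (proj E u, snd t u))"
    using assms(1,2) unfolding holomorphic_vector_bundle_def S_def by (cases t) fastforce
  have "topspace (subtopology (etop E) S) = S"
    by (auto simp: S_def)
  then have "(x, a) \<in> (\<lambda>u. (proj E u, snd t u)) ` S"
    using homeomorphic_imp_surjective_map[OF hom] assms(3) openin_subset[OF openin_triv[OF assms(1,2)]] by auto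
  then show ?thesis
    by (auto simp: fibre_def S_def)
qed

lemma triv_exists:
  assumes "holomorphic_vector_bundle M E" "x \<in> topspace (mtop M)"
  shows "\<exists>t\<in>trivs E. x \<in> fst t"
  using assms unfolding holomorphic_vector_bundle_def by blast

lemma proj_in_topspace:
  assumes "holomorphic_vector_bundle M E" "u \<in> topspace (etop E)"
  shows "proj E u \<in> topspace (mtop M)"
  using assms unfolding holomorphic_vector_bundle_def by blast

text \<open>\<open>zero_vec\<close> asks for some trivialization only; transition matrices are
  linear and map zero to zero, so all trivializations agree.\<close>

lemma zero_vec_iff:
  assumes "holomorphic_vector_bundle M E" "t \<in> trivs E" "u \<in> topspace (etop E)" "proj E u \<in> fst t"
  shows "zero_vec E u \<longleftrightarrow> snd t u = 0"
proof
  assume "zero_vec E u"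
  then obtain t' where t': "t' \<in> trivs E" "proj E u \<in> fst t'" "snd t' u = 0"
    by (auto simp: zero_vec_def)
  obtain V \<psi> V' \<psi>' where tt: "t = (V, \<psi>)" "t' = (V', \<psi>')"
    by (cases t, cases t')
  have "\<forall>(V, \<psi>)\<in>trivs E. \<forall>(V', \<psi>')\<in>trivs E. \<exists>G :: 'a \<Rightarrow> complex ^ 'd ^ 'd.
        (\<forall>\<alpha> \<beta>. holo_fun M (V \<inter> V') (\<lambda>x. G x $ \<alpha> $ \<beta>)) \<and>
        (\<forall>x\<in>V \<inter> V'. \<forall>u\<in>fibre E x. \<psi>' u = G x *v \<psi> u)"
    using assms(1) unfolding holomorphic_vector_bundle_def by (elim conjE)
  from bspec[OF this t'(1)[unfolded tt]]
  have "\<forall>(V, \<psi>)\<in>trivs E. \<exists>G :: 'a \<Rightarrow> complex ^ 'd ^ 'd.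
        (\<forall>\<alpha> \<beta>. holo_fun M (V' \<inter> V) (\<lambda>x. G x $ \<alpha> $ \<beta>)) \<and>
        (\<forall>x\<in>V' \<inter> V. \<forall>u\<in>fibre E x. \<psi> u = G x *v \<psi>' u)"
    by simp
  from bspec[OF this assms(2)[unfolded tt]]
  obtain G :: "'a \<Rightarrow> complex ^ 'd ^ 'd" where "\<forall>x\<in>V' \<inter> V. \<forall>u\<in>fibre E x. \<psi> u = G x *v \<psi>' u"
    by auto
  moreover have "proj E u \<in> V' \<inter> V" "u \<in> fibre E (proj E u)"
    using assms(3,4) t' tt by (auto simp: fibre_def)
  ultimately have "\<psi> u = G (proj E u) *v \<psi>' u"
    by blast
  then show "snd t u = 0"
    using t'(3) by (simp add: tt)
next
  assume "snd t u = 0"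
  then show "zero_vec E u"
    using assms by (auto simp: zero_vec_def)
qed

lemma frame_in_fibre:
  assumes "holomorphic_vector_bundle M E" "t \<in> trivs E" "x \<in> fst t"
  shows "frame E t \<alpha> x \<in> fibre E x"
proof -
  have "axis \<alpha> 1 \<in> snd t ` fibre E x"
    using triv_surj[OF assms, of "axis \<alpha> 1"] by (metis image_eqI)
  then show ?thesis
    unfolding frame_def by (rule inv_into_into)
qed

text \<open>Frame vectors lie in the fibre, which gives Hermitian symmetry of the components. Every
  coefficient vector comes from a vector of the fibre, which transfers positivity from
  \<open>E\<close> to the matrix.\<close>

lemma hermitian_metric_comps:
  assumes "holomorphic_vector_bundle M E" "hermitian_metric M E h" "t \<in> trivs E" "x \<in> fst t"
  shows "u \<in> fibre E x \<Longrightarrow> h u u = sesq (comps E t h x) (snd t u) (snd t u)"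
    and "pos_def_matrix (comps E t h x)"
proof -
  have her: "h u v = sesq (comps E t h x) (snd t u) (snd t v) \<and> h v u = cnj (h u v)"
    if "u \<in> fibre E x" "v \<in> fibre E x" for u v
    using assms(2-4) that unfolding hermitian_metric_def hermitian_tensor_def by blast
  then show eq: "h u u = sesq (comps E t h x) (snd t u) (snd t u)" if "u \<in> fibre E x" for u
    using that by blast
  have "comps E t h x $ \<beta> $ \<alpha> = cnj (comps E t h x $ \<alpha> $ \<beta>)" for \<alpha> \<beta>
    using her[OF frame_in_fibre[OF assms(1,3,4)] frame_in_fibre[OF assms(1,3,4)], of \<alpha> \<beta>]
    by (simp add: comps_def)
  moreover have "0 < Re (sesq (comps E t h x) a a)" if "a \<noteq> 0" for a
  proof -
    obtain v where v: "v \<in> fibre E x" "snd t v = a"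
      using triv_surj[OF assms(1,3,4)] by blast
    then have "\<not> zero_vec E v"
      using zero_vec_iff[OF assms(1,3), of v] assms(4) that by (auto simp: fibre_def)
    then show ?thesis
      using assms(2) v eq[OF v(1)] unfolding hermitian_metric_def pos_def_def fibre_def by auto
  qed
  ultimately show "pos_def_matrix (comps E t h x)"
    unfolding pos_def_matrix_def hermitian_matrix_def by blast
qed

lemma smooth_comps:
  assumes "hermitian_metric M E h" "t \<in> trivs E" "c \<in> atlas M"
  shows "smooth_on (snd c ` (fst c \<inter> fst t)) (comps E t h \<circ> param c)"
  using assms unfolding hermitian_metric_def smooth_fun_def by blast

lemma continuous_on_sesq:
  assumes "continuous_on S A" "continuous_on S u" "continuous_on S v"
  shows "continuous_on S (\<lambda>x. sesq (A x) (u x) (v x))"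
  unfolding sesq_def by (intro continuous_intros assms)

text \<open>Compactness enters through closed coordinate balls times the unit sphere of the fibre, so that the topology of the
  total space is not needed.\<close>

lemma local_max_quotient:
  assumes M: "complex_manifold M" and E: "holomorphic_vector_bundle M E"
    and h: "hermitian_metric M E h" and h0: "hermitian_metric M E h0"
    and x: "x \<in> topspace (mtop M)"
  shows "\<exists>X. openin (mtop M) X \<and> x \<in> X \<and> (\<exists>u\<in>topspace (etop E). \<not> zero_vec E u \<and>
    (\<forall>v\<in>topspace (etop E). \<not> zero_vec E v \<longrightarrow> proj E v \<in> X \<longrightarrow>
       Re (h v v) / Re (h0 v v) \<le> Re (h u u) / Re (h0 u u)))"
proof -
  obtain c where c: "c \<in> atlas M" "x \<in> fst c"
    using M x unfolding complex_manifold_def by blast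
  obtain t where t: "t \<in> trivs E" "x \<in> fst t"
    using triv_exists[OF E x] by blast
  define W where "W = snd c ` (fst c \<inter> fst t)"
  define H where "H = comps E t h \<circ> param c"
  define H0 where "H0 = comps E t h0 \<circ> param c"
  have "open W" "snd c x \<in> W"
    using open_chart_image[OF M c(1) openin_triv[OF E t(1)]] c t by (auto simp: W_def)
  \<comment> \<open>A closed ball inside \<open>W\<close> keeps the set \<open>K\<close> below both
    compact and within the domain of the components.\<close>
  then obtain e where e: "e > 0" "cball (snd c x) e \<subseteq> W"
    using open_contains_cball by blast
  have W: "param c w \<in> fst c \<inter> fst t" "snd c (param c w) = w" if "w \<in> W" for w
    using chart_param(2)[OF M c(1), of w "fst c \<inter> fst t"] that by (auto simp: W_def)
  have cont: "continuous_on W H" "continuous_on W H0"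
    using smooth_comps[OF h t(1) c(1)] smooth_comps[OF h0 t(1) c(1)]
    unfolding smooth_on_def W_def H_def H0_def by (metis Ck_on.simps(1))+
  have pos0: "pos_def_matrix (H0 w)" if "w \<in> W" for w
    using hermitian_metric_comps(2)[OF E h0 t(1)] W[OF that] by (simp add: H0_def)
  define f where "f = (\<lambda>(w, a). Re (sesq (H w) a a) / Re (sesq (H0 w) a a))"
  define K where "K = cball (snd c x) e \<times> sphere (0 :: complex ^ 'd) 1"
  have KW: "K \<subseteq> W \<times> sphere 0 1"
    using e(2) by (auto simp: K_def)
  have "\<exists>p\<in>K. \<forall>y\<in>K. f y \<le> f p"
  proof (rule continuous_attains_sup)
    show "compact K"
      unfolding K_def by (intro compact_Times compact_cball compact_sphere)
    \<comment> \<open>Any coordinate vector serves to show that the sphere is nonempty.\<close>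
    have "axis undefined 1 \<in> sphere (0 :: complex ^ 'd) 1"
      by simp
    then have "(snd c x, axis undefined 1) \<in> K"
      using e(1) by (simp add: K_def)
    then show "K \<noteq> {}"
      by blast
    have *: "continuous_on K (\<lambda>p. H (fst p))" "continuous_on K (\<lambda>p. H0 (fst p))"
      using KW by (auto intro!: continuous_on_compose2[OF cont(1)] continuous_on_compose2[OF cont(2)] continuous_intros)
    show "continuous_on K f"
      unfolding f_def case_prod_unfold
    proof (intro continuous_intros continuous_on_sesq *)
      show "\<forall>p\<in>K. Re (sesq (H0 (fst p)) (snd p) (snd p)) \<noteq> 0"
      proof
        fix p assume "p \<in> K"
        then have "fst p \<in> W" "snd p \<noteq> 0" using KW by auto
        with pos0[of "fst p"] show "Re (sesq (H0 (fst p)) (snd p) (snd p)) \<noteq> 0"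
          unfolding pos_def_matrix_def by (metis less_irrefl)
      qed
    qed
  qed
  then obtain w1 a1 where max: "(w1, a1) \<in> K" "\<And>w a. (w, a) \<in> K \<Longrightarrow> f (w, a) \<le> f (w1, a1)"
    by auto
  have fh: "Re (h v v) / Re (h0 v v) = f (w, snd t v)" if "w \<in> W" "v \<in> fibre E (param c w)" for v w
    using hermitian_metric_comps(1)[OF E h t(1) _ that(2)] hermitian_metric_comps(1)[OF E h0 t(1) _ that(2)] W[OF that(1)]
    by (simp add: f_def H_def H0_def)
  have w1: "w1 \<in> W" "a1 \<noteq> 0"
    using max(1) KW by auto
  obtain u where u: "u \<in> fibre E (param c w1)" "snd t u = a1"
    using triv_surj[OF E t(1)] W[OF w1(1)] by blast
  \<comment> \<open>Only the open ball is used for the neighbourhood; the maximizer \<open>u\<close>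
    may lie over the boundary of the closed ball, hence outside \<open>X\<close>.\<close>
  define X where "X = {y \<in> fst c. snd c y \<in> ball (snd c x) e} \<inter> fst t"
  show ?thesis
  proof (intro exI conjI bexI ballI impI)
    have "openin (subtopology (mtop M) (fst c)) {y \<in> topspace (subtopology (mtop M) (fst c)). snd c y \<in> snd c ` fst c \<inter> ball (snd c x) e}"
      by (rule openin_continuous_map_preimage[OF homeomorphic_imp_continuous_map[OF chart_homeo(3)[OF M c(1)]]])
         (simp add: openin_open_Int)
    then have "openin (mtop M) {y \<in> topspace (subtopology (mtop M) (fst c)). snd c y \<in> snd c ` fst c \<inter> ball (snd c x) e}"
      using chart_homeo(1)[OF M c(1)] by (rule openin_trans_full)
    also have "{y \<in> topspace (subtopology (mtop M) (fst c)). snd c y \<in> snd c ` fst c \<inter> ball (snd c x) e}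
        = {y \<in> fst c. snd c y \<in> ball (snd c x) e}"
      using openin_subset[OF chart_homeo(1)[OF M c(1)]] by auto
    finally show "openin (mtop M) X"
      unfolding X_def using openin_triv[OF E t(1)] by blast
    show "x \<in> X"
      using c t e by (simp add: X_def)
    show u_top: "u \<in> topspace (etop E)"
      using u by (simp add: fibre_def)
    show "\<not> zero_vec E u"
      using zero_vec_iff[OF E t(1) u_top] u w1 W[OF w1(1)] by (simp add: fibre_def)
    fix v assume v: "v \<in> topspace (etop E)" "\<not> zero_vec E v" "proj E v \<in> X"
    define w where "w = snd c (proj E v)"
    have pv: "proj E v \<in> fst c" "proj E v \<in> fst t" and wb: "w \<in> ball (snd c x) e"
      using v(3) by (auto simp: X_def w_def)
    then have w: "w \<in> W" "param c w = proj E v"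
      using chart_param(1)[OF M c(1)] by (auto simp: W_def w_def)
    have nz: "snd t v \<noteq> 0"
      using zero_vec_iff[OF E t(1) v(1) pv(2)] v(2) by simp
    \<comment> \<open>The quotient is invariant under scaling in the fibre, so \<open>v\<close> may
      be normalized to the unit sphere.\<close>
    define r where "r = complex_of_real (inverse (norm (snd t v)))"
    have r: "r \<noteq> 0" "(w, r *s snd t v) \<in> K"
    proof -
      show "r \<noteq> 0" using nz by (simp add: r_def)
      have "r *s snd t v = inverse (norm (snd t v)) *\<^sub>R snd t v"
        by (simp add: r_def vec_eq_iff scaleR_conv_of_real[where 'a = complex])
      then have "norm (r *s snd t v) = 1"
        using nz by simp
      then show "(w, r *s snd t v) \<in> K"
        using wb by (simp add: K_def)
    qed
    have "Re (h v v) / Re (h0 v v) = f (w, snd t v)"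
      using v(1) by (intro fh w) (simp add: fibre_def w)
    also have "\<dots> = f (w, r *s snd t v)"
    proof -
      have "sesq A (r *s snd t v) (r *s snd t v) = of_real ((cmod r)\<^sup>2) * sesq A (snd t v) (snd t v)" for A
        unfolding complex_norm_square by (simp add: sesq_scale_left sesq_scale_right mult_ac)
      then show ?thesis
        using r(1) by (simp add: f_def del: of_real_power)
    qed
    also have "\<dots> \<le> f (w1, a1)"
      by (rule max(2)[OF r(2)])
    also have "\<dots> = Re (h u u) / Re (h0 u u)"
      using fh[OF w1(1) u(1)] u(2) by simp
    finally show "Re (h v v) / Re (h0 v v) \<le> Re (h u u) / Re (h0 u u)" .
  qed
qed

text \<open>Finitely many of the neighbourhoods from \<open>local_max_quotient\<close> cover the
  base. Among the finitely many vectors dominating them, one with the largest quotient dominates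
  everything.\<close>

lemma global_max_quotient:
  assumes M: "complex_manifold M" and cpt: "compact_space (mtop M)" and E: "holomorphic_vector_bundle M E"
    and h: "hermitian_metric M E h" and h0: "hermitian_metric M E h0"
    and ne: "topspace (mtop M) \<noteq> {}"
  shows "\<exists>u\<in>topspace (etop E). \<not> zero_vec E u \<and>
    (\<forall>v\<in>topspace (etop E). \<not> zero_vec E v \<longrightarrow> Re (h v v) / Re (h0 v v) \<le> Re (h u u) / Re (h0 u u))"
proof -
  define Q where "Q v = Re (h v v) / Re (h0 v v)" for v
  define good where "good X u \<longleftrightarrow> u \<in> topspace (etop E) \<and> \<not> zero_vec E u \<and>
    (\<forall>v\<in>topspace (etop E). \<not> zero_vec E v \<longrightarrow> proj E v \<in> X \<longrightarrow> Q v \<le> Q u)" for X u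
  define \<U> where "\<U> = {X. openin (mtop M) X \<and> (\<exists>u. good X u)}"
  have "x \<in> \<Union>\<U>" if x: "x \<in> topspace (mtop M)" for x
    using local_max_quotient[OF M E h h0 x] unfolding \<U>_def good_def Q_def by blast
  then have "topspace (mtop M) \<subseteq> \<Union>\<U>" by blast
  moreover have "\<forall>X\<in>\<U>. openin (mtop M) X" by (simp add: \<U>_def)
  ultimately obtain \<F> where F: "finite \<F>" "\<F> \<subseteq> \<U>" "topspace (mtop M) \<subseteq> \<Union>\<F>"
    using cpt unfolding compact_space_alt by meson
  define u where "u X = (SOME u. good X u)" for X
  have u: "good X (u X)" if "X \<in> \<F>" for X
    using F(2) that someI_ex[of "good X"] unfolding \<U>_def u_def by blast
  have "\<F> \<noteq> {}" using F(3) ne by blast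
  then have "Max ((\<lambda>X. Q (u X)) ` \<F>) \<in> (\<lambda>X. Q (u X)) ` \<F>"
    using F(1) by (intro Max_in) auto
  then obtain X where X: "X \<in> \<F>" "Max ((\<lambda>X. Q (u X)) ` \<F>) = Q (u X)" by blast
  have "Q v \<le> Q (u X)" if v: "v \<in> topspace (etop E)" "\<not> zero_vec E v" for v
  proof -
    obtain Y where Y: "Y \<in> \<F>" "proj E v \<in> Y"
      using proj_in_topspace[OF E v(1)] F(3) by blast
    then have "Q v \<le> Q (u Y)"
      using u[OF Y(1)] v by (simp add: good_def)
    also have "\<dots> \<le> Q (u X)"
      unfolding X(2)[symmetric] using F(1) Y(1) by (intro Max_ge) auto
    finally show ?thesis .
  qed
  then show ?thesis
    using u[OF X(1)] unfolding good_def Q_def by blast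
qed

section \<open>From coordinates to the bundle, and the conclusion\<close>

lemma sesq_mean_curv_comps:
  "sesq (mean_curv_comps E g h c t x) u v = (\<Sum>i\<in>UNIV. \<Sum>j\<in>UNIV.
     matrix_inv (g c x) $ j $ i * sesq (chern_curv (comps E t h \<circ> param c) i j (snd c x)) u v)"
proof -
  define R where "R i j = chern_curv (comps E t h \<circ> param c) i j (snd c x)" for i j
  define G where "G = matrix_inv (g c x)"
  have "sesq (mean_curv_comps E g h c t x) u v
      = (\<Sum>\<alpha>\<in>UNIV. \<Sum>\<beta>\<in>UNIV. \<Sum>i\<in>UNIV. \<Sum>j\<in>UNIV. G $ j $ i * (R i j $ \<alpha> $ \<beta> * u $ \<alpha> * cnj (v $ \<beta>)))"
    by (simp add: sesq_def mean_curv_comps_def R_def G_def sum_distrib_right sum_distrib_left mult.assoc)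
  also have "\<dots> = (\<Sum>\<alpha>\<in>UNIV. \<Sum>i\<in>UNIV. \<Sum>j\<in>UNIV. \<Sum>\<beta>\<in>UNIV. G $ j $ i * (R i j $ \<alpha> $ \<beta> * u $ \<alpha> * cnj (v $ \<beta>)))"
    by (subst sum.swap, intro sum.cong refl, subst sum.swap) (rule refl)
  also have "\<dots> = (\<Sum>i\<in>UNIV. \<Sum>j\<in>UNIV. \<Sum>\<alpha>\<in>UNIV. \<Sum>\<beta>\<in>UNIV. G $ j $ i * (R i j $ \<alpha> $ \<beta> * u $ \<alpha> * cnj (v $ \<beta>)))"
    by (subst sum.swap, intro sum.cong refl, subst sum.swap) (rule refl)
  also have "\<dots> = (\<Sum>i\<in>UNIV. \<Sum>j\<in>UNIV. G $ j $ i * sesq (R i j) u v)"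
    by (simp add: sesq_def sum_distrib_left)
  finally show ?thesis
    unfolding R_def G_def .
qed

text \<open>The coordinate comparison is applied in the very chart and trivialization that
  \<open>mean_curv\<close> selects at the base point of \<open>u\<close>, so its conclusion is the
  inequality for \<open>mean_curv\<close> after unfolding.\<close>

lemma mean_curv_comparison_at_max:
  assumes M: "hermitian_manifold M g" and E: "holomorphic_vector_bundle M E"
    and h: "hermitian_metric M E h" and h0: "hermitian_metric M E h0"
    and u: "u \<in> topspace (etop E)"
    and le: "\<And>v. v \<in> topspace (etop E) \<Longrightarrow> Re (h v v) \<le> mu * Re (h0 v v)"
    and eq: "Re (h u u) = mu * Re (h0 u u)"
  shows "mu * Re (mean_curv M g E h0 u u) \<le> Re (mean_curv M g E h u u)"
proof -
  have cM: "complex_manifold M"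
    using M by (simp add: hermitian_manifold_def)
  define x where "x = proj E u"
  define c where "c = chart_at M x"
  define t where "t = triv_at E x"
  have x: "x \<in> topspace (mtop M)"
    using proj_in_topspace[OF E u] by (simp add: x_def)
  have "\<exists>c. c \<in> atlas M \<and> x \<in> fst c"
    using cM x unfolding complex_manifold_def by blast
  then have c: "c \<in> atlas M" "x \<in> fst c"
    unfolding c_def chart_at_def by (metis (mono_tags, lifting) someI_ex)+
  have "\<exists>t. t \<in> trivs E \<and> x \<in> fst t"
    using triv_exists[OF E x] by blast
  then have t: "t \<in> trivs E" "x \<in> fst t"
    unfolding t_def triv_at_def by (metis (mono_tags, lifting) someI_ex)+
  define W where "W = snd c ` (fst c \<inter> fst t)"
  have W: "open W" "snd c x \<in> W"
    using open_chart_image[OF cM c(1) openin_triv[OF E t(1)]] c t by (auto simp: W_def)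
  have pW: "param c w \<in> fst t" if "w \<in> W" for w
    using chart_param(2)[OF cM c(1), of w "fst c \<inter> fst t"] that by (auto simp: W_def)
  have px: "param c (snd c x) = x"
    by (rule chart_param(1)[OF cM c])
  have twice: "twice_differentiable_on W (\<lambda>w. (comps E t k \<circ> param c) w $ \<alpha> $ \<beta>)"
    if "hermitian_metric M E k" for k \<alpha> \<beta>
  proof -
    have "bounded_linear (\<lambda>A :: complex ^ 'd ^ 'd. A $ \<alpha> $ \<beta>)"
      by (rule bounded_linear_compose[OF bounded_linear_vec_nth bounded_linear_vec_nth])
    from twice_differentiable_on_bounded_linear[OF W(1) this]
    show ?thesis
      using smooth_on_imp_twice_differentiable_on[OF smooth_comps[OF that t(1) c(1)]] unfolding W_def by blast
  qed
  have "mu * Re (\<Sum>i\<in>UNIV. \<Sum>j\<in>UNIV. matrix_inv (g c x) $ j $ i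
        * sesq (chern_curv (comps E t h0 \<circ> param c) i j (snd c x)) (snd t u) (snd t u))
    \<le> Re (\<Sum>i\<in>UNIV. \<Sum>j\<in>UNIV. matrix_inv (g c x) $ j $ i
        * sesq (chern_curv (comps E t h \<circ> param c) i j (snd c x)) (snd t u) (snd t u))"
  proof (rule mean_curvature_comparison[OF W twice[OF h] twice[OF h0]])
    show "pos_def_matrix ((comps E t h \<circ> param c) w)" "pos_def_matrix ((comps E t h0 \<circ> param c) w)" if "w \<in> W" for w
      using hermitian_metric_comps(2)[OF E h t(1)] hermitian_metric_comps(2)[OF E h0 t(1)] pW[OF that] by simp_all
    show "pos_def_matrix (g c x)"
      using M c by (simp add: hermitian_manifold_def)
    \<comment> \<open>Each coefficient vector \<open>a\<close> is realized by a vector of the fibre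
      over \<open>param c w\<close>, to which the global bound applies.\<close>
    show "Re (sesq ((comps E t h \<circ> param c) w) a a) \<le> mu * Re (sesq ((comps E t h0 \<circ> param c) w) a a)" if w: "w \<in> W" for w a
    proof -
      obtain v where v: "v \<in> fibre E (param c w)" "snd t v = a"
        using triv_surj[OF E t(1) pW[OF w]] by blast
      with le[of v] hermitian_metric_comps(1)[OF E h t(1) pW[OF w] v(1)]
        hermitian_metric_comps(1)[OF E h0 t(1) pW[OF w] v(1)]
      show ?thesis by (simp add: fibre_def)
    qed
    have "u \<in> fibre E x"
      using u by (simp add: fibre_def x_def)
    then show "Re (sesq ((comps E t h \<circ> param c) (snd c x)) (snd t u) (snd t u))
        = mu * Re (sesq ((comps E t h0 \<circ> param c) (snd c x)) (snd t u) (snd t u))"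
      using eq hermitian_metric_comps(1)[OF E h t] hermitian_metric_comps(1)[OF E h0 t] by (simp add: px)
  qed
  then show ?thesis
    by (simp add: mean_curv_def Let_def sesq_mean_curv_comps flip: x_def c_def t_def)
qed

theorem theorem1p3:
  fixes M :: "('m, 'n::finite) cmfd"
    and g :: "('m, 'n) metric_comps"
    and E :: "('m, 'e, 'r::finite) vbun"
    and h h0 :: "'e \<Rightarrow> 'e \<Rightarrow> complex"
    and lam :: real
  assumes "hermitian_manifold M g"
    and "compact_space (mtop M)"
    and "holomorphic_vector_bundle M E"
    and "hermitian_metric M E h"
    and "hermitian_metric M E h0"
    and "tensor_less E (\<lambda>u v. 0)
           (\<lambda>u v. mean_curv M g E h0 u v - complex_of_real lam * h0 u v)"
    and "tensor_le E
           (\<lambda>u v. mean_curv M g E h u v - complex_of_real lam * h u v)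
           (\<lambda>u v. mean_curv M g E h0 u v - complex_of_real lam * h0 u v)"
  shows "tensor_le E h h0"
proof (rule ccontr)
  assume "\<not> tensor_le E h h0"
  then obtain u1 where u1: "u1 \<in> topspace (etop E)" "Re (h0 u1 u1) < Re (h u1 u1)"
    unfolding tensor_le_def pos_semidef_def by auto
  note E = assms(3) and h = assms(4) and h0 = assms(5)
  have M: "complex_manifold M"
    using assms(1) by (simp add: hermitian_manifold_def)
  have pos0: "0 < Re (h0 v v)" if "v \<in> topspace (etop E)" "\<not> zero_vec E v" for v
    using h0 that unfolding hermitian_metric_def pos_def_def by blast
  \<comment> \<open>On zero vectors the quotient says nothing, but both metrics vanish there. Hence
    \<open>u1\<close> is nonzero, and \<open>le\<close> below extends to all vectors.\<close>
  have zero: "k v v = 0" if k: "hermitian_metric M E k" and v: "v \<in> topspace (etop E)" "zero_vec E v" for k v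
  proof -
    obtain t where t: "t \<in> trivs E" "proj E v \<in> fst t"
      using triv_exists[OF E proj_in_topspace[OF E v(1)]] by blast
    then show ?thesis
      using hermitian_metric_comps(1)[OF E k t, of v] zero_vec_iff[OF E t(1) v(1) t(2)] v
      by (simp add: fibre_def)
  qed
  have nz1: "\<not> zero_vec E u1"
    using zero[OF h u1(1)] zero[OF h0 u1(1)] u1(2) by fastforce
  obtain u where u: "u \<in> topspace (etop E)" "\<not> zero_vec E u"
    and max: "\<And>v. v \<in> topspace (etop E) \<Longrightarrow> \<not> zero_vec E v \<Longrightarrow> Re (h v v) / Re (h0 v v) \<le> Re (h u u) / Re (h0 u u)"
    using global_max_quotient[OF M assms(2) E h h0] proj_in_topspace[OF E u1(1)] by blast
  define mu where "mu = Re (h u u) / Re (h0 u u)"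
  have "1 < Re (h u1 u1) / Re (h0 u1 u1)"
    using u1 pos0[OF u1(1) nz1] by simp
  also have "\<dots> \<le> mu"
    unfolding mu_def by (rule max[OF u1(1) nz1])
  finally have mu: "1 < mu" .
  \<comment> \<open>With \<open>le\<close>, this says that \<open>mu * h0 - h\<close> is nonnegative
    on the diagonal and vanishes at \<open>u\<close>.\<close>
  have eq: "Re (h u u) = mu * Re (h0 u u)"
    using pos0[OF u] by (simp add: mu_def)
  have le: "Re (h v v) \<le> mu * Re (h0 v v)" if "v \<in> topspace (etop E)" for v
  proof (cases "zero_vec E v")
    case True
    then show ?thesis
      using zero[OF h that] zero[OF h0 that] by simp
  next
    case False
    then show ?thesis
      using max[OF that] pos0[OF that] by (simp add: mu_def[symmetric] pos_divide_le_eq)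
  qed
  define k0 where "k0 = Re (mean_curv M g E h0 u u) - lam * Re (h0 u u)"
  have k0: "0 < k0"
    using assms(6) u unfolding tensor_less_def pos_def_def k0_def by fastforce
  \<comment> \<open>By \<open>eq\<close>, \<open>lam * Re (h u u)\<close> is
    \<open>mu * (lam * Re (h0 u u))\<close>; subtracting it from the comparison of mean curvatures
    works for either sign of \<open>lam\<close>.\<close>
  have "mu * k0 \<le> Re (mean_curv M g E h u u) - lam * Re (h u u)"
    using mean_curv_comparison_at_max[OF assms(1) E h h0 u(1) le eq] by (simp add: k0_def eq algebra_simps)
  also have "\<dots> \<le> k0"
    using assms(7) u unfolding tensor_le_def pos_semidef_def k0_def by fastforce
  finally show False
    using k0 mu by (simp add: mult_le_cancel_right1)
qed

end
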